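(* Let $\mathbf F=(F_k)_{k=1}^\infty$ with $F_k=\{0,1,\ldots,k-1\}$, and suppose that $T:\mathbb N_0\curvearrowright X$ is a Hölder action on $X$, with modulus of Hölder continuity $(H,L)$, that has the Very Weak Specification Property. Suppose $\Pi$ is a countable sampling family. Then the set of $x\in X$ such that $$\operatorname{LS}\left(\left(\alpha_{B\left(x;r_{\pi(k)}\right)}\circ\operatorname{Avg}_{F_{\pi(k)}}\right)_{k=1}^\infty\right)=\mathcal M_T(X)$$ for all $(r_k)_{k=1}^\infty$ that decay $(X,\rho,H,L,\mathbf F)$-fast and all $\pi\in\Pi$ is a residual subset of $X$.
   Context: $(X,\rho)$ is a compact metric space, $\mu$ is a Borel probability measure on $X$, and $T:\mathbb N_0\curvearrowright X$ is an action of the additive monoid $\mathbb N_0$ of nonnegative integers by continuous, not necessarily invertible, maps $(T_j)_{j\in\mathbb N_0}$ ($T_i\circ T_j=T_{i+j}$, $T_0=\mathrm{id}_X$). $\mathbb N$ is the set of positive integers. The action is Hölder with modulus of Hölder continuity $(H,L)$ if $H,L:\mathbb N_0\to(0,\infty)$ satisfy $\rho(T_jx,T_jy)\le L(j)\cdot\rho(x,y)^{H(j)}$ for all $j\in\mathbb N_0$, $x,y\in X$. A sequence $(r_k)_{k=1}^\infty$ of positive numbers decays $(X,\rho,H,L,\mathbf F)$-fast if $\lim_{k\to\infty}r_k=0$ and, for all $\delta\in(0,\infty)$, $\lim_{k\to\infty}\frac{|\{j\in F_k:L(j)\cdot r_k^{H(j)}>\delta\}|}{|F_k|}=0$. $\mathcal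 M(X)$ is the space of Borel probability measures on $X$ with the weak* topology and $\mathcal M_T(X)$ the subspace of $T$-invariant ones. $B(x;r)=\{y\in X:\rho(x,y)<r\}$. For measurable $E\subseteq X$ with $\mu(E)>0$, $\alpha_E$ is the Borel probability measure $A\mapsto\mu(A\cap E)/\mu(E)$. For $\beta\in\mathcal M(X)$ and finite nonempty $F\subseteq\mathbb N_0$, $\beta\circ\operatorname{Avg}_F\in\mathcal M(X)$ is defined by $(\beta\circ\operatorname{Avg}_F)(A)=\frac1{|F|}\sum_{j\in F}\beta(T_j^{-1}A)$. For a sequence $(z_k)_{k=1}^\infty$, $\operatorname{LS}((z_k)_{k=1}^\infty)$ is the set of all limits of convergent subsequences (here in $\mathcal M(X)$). A subset of $X$ is residual if it contains a dense $G_\delta$ set. A sampling family is a family $\Pi$ of functions $\pi:\mathbb N\to\mathbb N$ such that $\lim_{k\to\infty}\pi(k)=+\infty$ for all $\pi\in\Pi$. A specification is a finite sequence $\xi=\{([a_j,b_j],x_j)\}_{j=1}^n$ of finite subintervals $[a_j,b_j]$ of $\mathbb N$ and points $x_j\in X$. Given $\mathbf M:\mathbb N\to\mathbb N$, $\xi$ is $\mathbf M$-spaced if $a_j-b_{j-1}\ge\mathbf M(j)$ for all $j=2,\ldots,n$. For $\delta>0$, a point $y\in X$ is a $\delta$-tracing of $\xi$ if $\rho(T_ix_j,T_{a_j+i}y)<\delta$ for all $j=1,\ldots,n$ and $i=0,1,\ldots,b_j-a_j$. $T$ has the Very Weak Specification Property if there is a family of functions $(\mathbf M_\delta:\mathbb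 N\to\mathbb N)_{\delta\in(0,1)}$ such that for every $\delta\in(0,1)$ every $\mathbf M_\delta$-spaced specification admits a $\delta$-tracing.
   Formalization: The identity LS(...) = M_T(X) is required only when all the balls B(x; r_{π(k)}) have positive μ-measure, so that the measures α are defined (i.e. x lies in the support of μ); if μ has full support this is automatic. *)

theory Defs
  imports "HOL-Probability.Probability_Measure"
begin

text \<open>
  The compact metric space \<open>X\<close> is a type \<open>'a::metric_space\<close> with \<open>compact (UNIV :: 'a set)\<close>.
  Sequences \<open>(z\<^sub>k)\<close> with \<open>k = 1, 2, \<dots>\<close> are functions on \<^typ>\<open>nat\<close> whose value at \<open>0\<close> is
  never used; likewise maps from the positive integers to themselves are functions
  \<^typ>\<open>nat \<Rightarrow> nat\<close> that are positive at positive arguments.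
\<close>

definition residual :: "'a::topological_space set \<Rightarrow> bool" where
  "residual S \<longleftrightarrow> (\<exists>G. gdelta_in euclidean G \<and> closure G = UNIV \<and> G \<subseteq> S)"


subsection \<open>Borel probability measures and the weak* topology\<close>

definition borel_probs :: "'a::topological_space measure set" where
  "borel_probs = {\<beta>. sets \<beta> = sets borel \<and> prob_space \<beta>}"

text \<open>
  The coarsest topology on \<^const>\<open>borel_probs\<close> for which integration against every
  continuous real function is continuous. No boundedness is imposed on the test functions,
  since the definition is used for compact spaces.
\<close>

definition weak_star :: "'a::topological_space measure topology" where
  "weak_star =
     pullback_topology borel_probs
       (\<lambda>\<beta>. \<lambda>f\<in>{f :: 'a \<Rightarrow> real. continuous_on UNIV f}. \<integral>x. f x \<partial>\<beta>)
       (product_topology (\<lambda>_. euclideanreal) {f :: 'a \<Rightarrow> real. continuous_on UNIV f})"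

lemma topspace_weak_star: "topspace weak_star = borel_probs"
  by (auto simp: weak_star_def topspace_pullback_topology topspace_product_topology)

lemma limitin_weak_star_iff:
  fixes z :: "nat \<Rightarrow> 'a::topological_space measure"
  assumes "\<And>k. z k \<in> borel_probs" "\<beta> \<in> borel_probs"
  shows "limitin weak_star z \<beta> sequentially \<longleftrightarrow>
           (\<forall>f :: 'a \<Rightarrow> real. continuous_on UNIV f \<longrightarrow> (\<lambda>k. \<integral>x. f x \<partial>z k) \<longlonglongrightarrow> (\<integral>x. f x \<partial>\<beta>))"
proof -
  let ?C = "{f :: 'a \<Rightarrow> real. continuous_on UNIV f}"
  let ?h = "\<lambda>\<beta> :: 'a measure. \<lambda>f\<in>?C. \<integral>x. f x \<partial>\<beta>"
  let ?P = "product_topology (\<lambda>_. euclideanreal) ?C"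
  have "limitin weak_star z \<beta> sequentially \<longleftrightarrow> limitin ?P (\<lambda>k. ?h (z k)) (?h \<beta>) sequentially"
  proof
    assume L: "limitin weak_star z \<beta> sequentially"
    show "limitin ?P (\<lambda>k. ?h (z k)) (?h \<beta>) sequentially"
      unfolding limitin_def
    proof (intro conjI allI impI)
      show "?h \<beta> \<in> topspace ?P" by auto
      fix U assume "openin ?P U \<and> ?h \<beta> \<in> U"
      then have "openin weak_star (?h -` U \<inter> borel_probs)" "\<beta> \<in> ?h -` U \<inter> borel_probs"
        using assms by (auto simp: weak_star_def openin_pullback_topology)
      then have "eventually (\<lambda>k. z k \<in> ?h -` U \<inter> borel_probs) sequentially"
        using L unfolding limitin_def by blast
      then show "eventually (\<lambda>k. ?h (z k) \<in> U) sequentially"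
        by (rule eventually_mono) auto
    qed
  next
    assume L: "limitin ?P (\<lambda>k. ?h (z k)) (?h \<beta>) sequentially"
    show "limitin weak_star z \<beta> sequentially"
      unfolding limitin_def
    proof (intro conjI allI impI)
      show "\<beta> \<in> topspace weak_star" using assms by (simp add: topspace_weak_star)
      fix V assume V: "openin weak_star V \<and> \<beta> \<in> V"
      then obtain U where U: "openin ?P U" "V = ?h -` U \<inter> borel_probs"
        unfolding weak_star_def openin_pullback_topology by blast
      then have "eventually (\<lambda>k. ?h (z k) \<in> U) sequentially"
        using L V unfolding limitin_def by blast
      then show "eventually (\<lambda>k. z k \<in> V) sequentially"
        by (rule eventually_mono) (use U assms in auto)
    qed
  qed
  then show ?thesis
    by (auto simp: limitin_componentwise)
qed

text \<open>The set of all limits of convergent subsequences of \<open>(z\<^sub>k)\<close>, \<open>k \<ge> 1\<close>.\<close>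

definition LS :: "'b topology \<Rightarrow> (nat \<Rightarrow> 'b) \<Rightarrow> 'b set" where
  "LS W z = {l. \<exists>s :: nat \<Rightarrow> nat. strict_mono s \<and> (\<forall>i. s i \<ge> 1) \<and> limitin W (z \<circ> s) l sequentially}"


subsection \<open>Actions of the additive monoid of nonnegative integers\<close>

definition nat_action :: "(nat \<Rightarrow> 'a::topological_space \<Rightarrow> 'a) \<Rightarrow> bool" where
  "nat_action T \<longleftrightarrow>
     (\<forall>j. continuous_on UNIV (T j)) \<and> T 0 = id \<and> (\<forall>i j. T i \<circ> T j = T (i + j))"

definition invariant_probs :: "(nat \<Rightarrow> 'a::topological_space \<Rightarrow> 'a) \<Rightarrow> 'a measure set" where
  "invariant_probs T =
     {\<beta>\<in>borel_probs. \<forall>j. \<forall>A\<in>sets borel. emeasure \<beta> (T j -` A) = emeasure \<beta> A}"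

definition avg ::
    "(nat \<Rightarrow> 'a::topological_space \<Rightarrow> 'a) \<Rightarrow> nat set \<Rightarrow> 'a measure \<Rightarrow> 'a measure" where
  "avg T F \<beta> =
     measure_of UNIV (sets borel) (\<lambda>A. (\<Sum>j\<in>F. emeasure \<beta> (T j -` A)) / of_nat (card F))"

lemma emeasure_avg:
  assumes "nat_action T" "sets \<beta> = sets borel" "A \<in> sets borel"
  shows "emeasure (avg T F \<beta>) A = (\<Sum>j\<in>F. emeasure \<beta> (T j -` A)) / of_nat (card F)"
    (is "_ = ?m A")
proof -
  have space: "space \<beta> = UNIV"
    using sets_eq_imp_space_eq[OF assms(2)] by simp
  have meas: "T j -` B \<in> sets \<beta>" if "B \<in> sets borel" for j B
  proof -
    have "T j \<in> borel_measurable borel"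
      using assms(1) by (intro borel_measurable_continuous_onI) (auto simp: nat_action_def)
    from measurable_sets[OF this that] show ?thesis by (simp add: assms(2))
  qed
  have "countably_additive (sets borel) ?m"
  proof (rule countably_additiveI)
    fix B :: "nat \<Rightarrow> 'a set"
    assume B: "range B \<subseteq> sets borel" "disjoint_family B"
    have "(\<Sum>i. emeasure \<beta> (T j -` B i)) = emeasure \<beta> (T j -` (\<Union>i. B i))" for j
    proof -
      have "disjoint_family (\<lambda>i. T j -` B i)"
        using B(2) by (auto simp: disjoint_family_on_def)
      moreover have "range (\<lambda>i. T j -` B i) \<subseteq> sets \<beta>"
        using B(1) meas by auto
      ultimately show ?thesis
        using suminf_emeasure[of "\<lambda>i. T j -` B i" \<beta>] by (simp add: vimage_UN)
    qed
    then show "(\<Sum>i. ?m (B i)) = ?m (\<Union>i. B i)"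
      by (simp add: divide_ennreal_def suminf_sum)
  qed
  moreover have "positive (sets borel) ?m"
    by (simp add: positive_def)
  moreover have "sigma_algebra UNIV (sets (borel :: 'a measure))"
    using sets.sigma_algebra_axioms[of "borel :: 'a measure"] by simp
  ultimately show ?thesis
    unfolding avg_def using assms(3) by (intro emeasure_measure_of_sigma) auto
qed


subsection \<open>Hoelder actions, fast decay and sampling families\<close>

definition holder_action ::
    "(nat \<Rightarrow> 'a::metric_space \<Rightarrow> 'a) \<Rightarrow> (nat \<Rightarrow> real) \<Rightarrow> (nat \<Rightarrow> real) \<Rightarrow> bool" where
  "holder_action T H L \<longleftrightarrow>
     (\<forall>j. H j > 0) \<and> (\<forall>j. L j > 0) \<and>
     (\<forall>j x y. dist (T j x) (T j y) \<le> L j * dist x y powr H j)"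

definition decays_fast ::
    "(nat \<Rightarrow> real) \<Rightarrow> (nat \<Rightarrow> real) \<Rightarrow> (nat \<Rightarrow> nat set) \<Rightarrow> (nat \<Rightarrow> real) \<Rightarrow> bool" where
  "decays_fast H L F r \<longleftrightarrow>
     (\<forall>k\<ge>1. r k > 0) \<and> r \<longlonglongrightarrow> 0 \<and>
     (\<forall>\<delta>>0. (\<lambda>k. real (card {j\<in>F k. L j * r k powr H j > \<delta>}) / real (card (F k))) \<longlonglongrightarrow> 0)"

definition sampling_family :: "(nat \<Rightarrow> nat) set \<Rightarrow> bool" where
  "sampling_family \<P> \<longleftrightarrow> (\<forall>\<pi>\<in>\<P>. (\<forall>k\<ge>1. \<pi> k \<ge> 1) \<and> filterlim \<pi> at_top sequentially)"


subsection \<open>Specifications\<close>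

text \<open>
  Specifications with \<open>n\<close> entries are given by the endpoints \<open>a j\<close>, \<open>b j\<close> and the points
  \<open>x j\<close> for \<open>j \<in> {1..n}\<close>.
\<close>

definition is_spec :: "nat \<Rightarrow> (nat \<Rightarrow> nat) \<Rightarrow> (nat \<Rightarrow> nat) \<Rightarrow> bool" where
  "is_spec n a b \<longleftrightarrow> (\<forall>j\<in>{1..n}. 1 \<le> a j \<and> a j \<le> b j)"

definition spaced :: "(nat \<Rightarrow> nat) \<Rightarrow> nat \<Rightarrow> (nat \<Rightarrow> nat) \<Rightarrow> (nat \<Rightarrow> nat) \<Rightarrow> bool" where
  "spaced M n a b \<longleftrightarrow> (\<forall>j\<in>{2..n}. int (a j) - int (b (j - 1)) \<ge> int (M j))"

definition tracing ::
    "(nat \<Rightarrow> 'a::metric_space \<Rightarrow> 'a) \<Rightarrow> real \<Rightarrow> nat \<Rightarrow> (nat \<Rightarrow> nat) \<Rightarrow> (nat \<Rightarrow> nat) \<Rightarrow> (nat \<Rightarrow> 'a) \<Rightarrow> 'a \<Rightarrow> bool" where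
  "tracing T \<delta> n a b x y \<longleftrightarrow>
     (\<forall>j\<in>{1..n}. \<forall>i\<in>{0..b j - a j}. dist (T i (x j)) (T (a j + i) y) < \<delta>)"

definition very_weak_specification :: "(nat \<Rightarrow> 'a::metric_space \<Rightarrow> 'a) \<Rightarrow> bool" where
  "very_weak_specification T \<longleftrightarrow>
     (\<exists>M :: real \<Rightarrow> nat \<Rightarrow> nat. \<forall>\<delta>\<in>{0<..<1}.
        (\<forall>j\<ge>1. M \<delta> j \<ge> 1) \<and>
        (\<forall>n a b x. is_spec n a b \<longrightarrow> spaced (M \<delta>) n a b \<longrightarrow> (\<exists>y. tracing T \<delta> n a b x y)))"

end

theory Submission
  imports Defs "HOL-Probability.Probability"
begin

text \<open>
  Fast decay makes \<open>T j\<close> nearly constant on the ball \<open>B(x; r\<^sub>k)\<close> for most \<open>j < k\<close>, so against a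
  continuous function the averaged ball measures are asymptotic to the Birkhoff averages at \<open>x\<close>;
  the sequence \<open>r\<close> disappears, and telescoping shows that all limits are invariant.

  For the converse, by Baire and a countable uniformly dense set of test functions it suffices that
  near every point there are \<open>y\<close> whose Birkhoff averages of any large length \<open>K\<close> approximate a
  given invariant \<open>\<beta>\<close> on finitely many test functions. Birkhoff averages of any length \<open>l\<close> have the
  same \<open>\<beta>\<close>-mean as the function itself, so finitely many points, their number \<open>p\<close> depending only on
  the accuracy and not on \<open>l\<close>, have orbit segments of length \<open>l\<close> whose joint average is close to
  \<open>\<beta>\<close>. (This replaces the ergodic theorem and ergodic decomposition.) The specification property
  glues these \<open>p\<close> segments with gaps that do not depend on \<open>l\<close>, hence are negligible as \<open>K \<rightarrow> \<infinity>\<close>.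
\<close>

subsection \<open>Birkhoff averages\<close>

definition birkhoff :: "(nat \<Rightarrow> 'a \<Rightarrow> 'a) \<Rightarrow> nat \<Rightarrow> ('a \<Rightarrow> real) \<Rightarrow> 'a \<Rightarrow> real" where
  "birkhoff T K f x = (\<Sum>j<K. f (T j x)) / real K"

lemma continuous_bounded:
  fixes f :: "'a::metric_space \<Rightarrow> real"
  assumes "compact (UNIV :: 'a set)" "continuous_on UNIV f"
  obtains B where "B > 0" "\<And>x. \<bar>f x\<bar> \<le> B"
proof -
  have "bounded (range f)"
    using assms compact_continuous_image compact_imp_bounded by blast
  then show ?thesis
    using that unfolding bounded_pos by auto
qed

lemma continuous_uniform:
  fixes f :: "'a::metric_space \<Rightarrow> real"
  assumes "compact (UNIV :: 'a set)" "continuous_on UNIV f" "e > 0"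
  obtains d where "d > 0" "\<And>x y. dist x y < d \<Longrightarrow> \<bar>f x - f y\<bar> < e"
  using compact_uniformly_continuous[OF assms(2,1)] assms(3) that
  unfolding uniformly_continuous_on_def dist_real_def by (metis UNIV_I dist_commute)

lemma nat_action_continuous: "nat_action T \<Longrightarrow> continuous_on UNIV (T j)"
  by (simp add: nat_action_def)

lemma nat_action_add: "nat_action T \<Longrightarrow> T i (T j x) = T (i + j) x"
  by (metis comp_apply nat_action_def)

lemma nat_action_0: "nat_action T \<Longrightarrow> T 0 x = x"
  by (simp add: nat_action_def)

lemma continuous_on_action:
  assumes "nat_action T" "continuous_on UNIV (f :: _ \<Rightarrow> real)"
  shows "continuous_on UNIV (\<lambda>x. f (T j x))"
  using continuous_on_compose2[OF assms(2) nat_action_continuous[OF assms(1)]] by auto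

lemma continuous_on_birkhoff:
  assumes "nat_action T" "continuous_on UNIV f"
  shows "continuous_on UNIV (birkhoff T K f)"
proof -
  have "continuous_on UNIV (\<lambda>x. \<Sum>j<K. f (T j x))"
    by (rule continuous_on_sum) (rule continuous_on_action[OF assms])
  then show ?thesis
    unfolding birkhoff_def divide_inverse by (rule continuous_on_mult_right)
qed

lemma birkhoff_close:
  assumes "\<And>x. \<bar>f x - g x\<bar> \<le> e" "K > 0"
  shows "\<bar>birkhoff T K f x - birkhoff T K g x\<bar> \<le> e"
proof -
  have "\<bar>\<Sum>j<K. f (T j x) - g (T j x)\<bar> \<le> (\<Sum>j<K. e)"
    by (rule order_trans[OF sum_abs sum_mono]) (rule assms)
  then show ?thesis
    using assms(2)
    by (simp add: birkhoff_def diff_divide_distrib[symmetric] sum_subtractf abs_divide divide_le_eq mult.commute)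
qed

lemma birkhoff_bounded:
  assumes "\<And>x. \<bar>f x\<bar> \<le> B" "K > 0"
  shows "\<bar>birkhoff T K f x\<bar> \<le> B"
  using birkhoff_close[of f "\<lambda>_. 0" B K T x] assms by (simp add: birkhoff_def)

text \<open>The two sums telescope. For bounded \<open>f\<close> the right-hand side is of order
  \<open>1 / K\<close>, which is what makes limits of Birkhoff averages invariant.\<close>

lemma birkhoff_shift:
  assumes "nat_action T"
  shows "birkhoff T K (\<lambda>x. f (T 1 x)) x - birkhoff T K f x = (f (T K x) - f x) / real K"
proof -
  have "(\<Sum>j<K. f (T 1 (T j x))) - (\<Sum>j<K. f (T j x)) = f (T K x) - f x"
    using sum_lessThan_telescope[of "\<lambda>j. f (T j x)" K] assms
    by (simp add: nat_action_add nat_action_0 sum_subtractf)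
  then show ?thesis
    by (simp add: birkhoff_def diff_divide_distrib[symmetric])
qed

subsection \<open>Invariant and averaged measures\<close>

lemma borel_probs_integrable:
  fixes f :: "'a::metric_space \<Rightarrow> real"
  assumes "compact (UNIV :: 'a set)" "\<beta> \<in> borel_probs" "continuous_on UNIV f"
  shows "integrable \<beta> f"
proof -
  interpret prob_space \<beta> using assms by (simp add: borel_probs_def)
  obtain B where "\<And>x. \<bar>f x\<bar> \<le> B"
    using continuous_bounded[OF assms(1,3)] by blast
  moreover have "f \<in> borel_measurable \<beta>"
    using assms
    by (subst measurable_cong_sets[of \<beta> borel])
      (auto simp: borel_probs_def intro: borel_measurable_continuous_onI)
  ultimately show ?thesis
    by (intro integrable_const_bound[of _ B]) auto
qed

text \<open>Integrals of continuous functions determine the measure of every closed set by dominated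
  convergence, and the closed sets are an intersection-stable generator of the Borel sets.\<close>

lemma borel_probs_eqI:
  fixes \<beta> \<gamma> :: "'a::metric_space measure"
  assumes cpt: "compact (UNIV :: 'a set)" and "\<beta> \<in> borel_probs" "\<gamma> \<in> borel_probs"
    and eq: "\<And>f :: 'a \<Rightarrow> real. continuous_on UNIV f \<Longrightarrow> (\<integral>x. f x \<partial>\<beta>) = (\<integral>x. f x \<partial>\<gamma>)"
  shows "\<beta> = \<gamma>"
proof -
  \<comment> \<open>the continuous functions \<open>(1 / (1 + infdist x C)) ^ n\<close> decrease to the indicator of \<open>C\<close>\<close>
  have closed_lim: "(\<lambda>n. \<integral>x. (1 / (1 + infdist x C)) ^ n \<partial>\<alpha>) \<longlonglongrightarrow> measure \<alpha> C"
    if C: "closed C" "C \<noteq> {}" and \<alpha>: "\<alpha> \<in> borel_probs" for C :: "'a set" and \<alpha>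
  proof -
    interpret prob_space \<alpha> using \<alpha> by (simp add: borel_probs_def)
    have s: "sets \<alpha> = sets borel" using \<alpha> by (simp add: borel_probs_def)
    have [measurable_cong]: "sets \<alpha> = sets borel" by (rule s)
    have [measurable]: "C \<in> sets borel" using C by auto
    have *: "1 + infdist x C \<noteq> 0" for x using infdist_nonneg[of x C] by linarith
    have [measurable]: "(\<lambda>x. (1 / (1 + infdist x C)) ^ n) \<in> borel_measurable borel" for n
      by (intro borel_measurable_continuous_onI continuous_intros) (use * in auto)
    have "(\<lambda>n. \<integral>x. (1 / (1 + infdist x C)) ^ n \<partial>\<alpha>) \<longlonglongrightarrow> (\<integral>x. indicator C x \<partial>\<alpha>)"
    proof (rule integral_dominated_convergence[where w="\<lambda>_. 1"])
      show "AE x in \<alpha>. (\<lambda>n. (1 / (1 + infdist x C)) ^ n) \<longlonglongrightarrow> indicator C x"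
      proof (rule AE_I2)
        fix x
        show "(\<lambda>n. (1 / (1 + infdist x C)) ^ n) \<longlonglongrightarrow> indicator C x"
        proof (cases "x \<in> C")
          case True
          then show ?thesis by simp
        next
          case False
          then have "infdist x C > 0"
            using C in_closed_iff_infdist_zero infdist_nonneg by (metis less_eq_real_def)
          then show ?thesis using False by (auto intro!: LIMSEQ_power_zero)
        qed
      qed
      show "AE x in \<alpha>. norm ((1 / (1 + infdist x C)) ^ n) \<le> 1" for n
        proof (rule AE_I2)
        fix x
        have "0 \<le> 1 / (1 + infdist x C)" "1 / (1 + infdist x C) \<le> 1"
          using infdist_nonneg[of x C] by simp_all
        then show "norm ((1 / (1 + infdist x C)) ^ n) \<le> 1"
          by (metis abs_of_nonneg norm_power power_le_one real_norm_def)
      qed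
    qed auto
    then show ?thesis by (simp add: s)
  qed
  have s: "sets \<beta> = sets borel" "sets \<gamma> = sets borel" and p: "prob_space \<beta>" "prob_space \<gamma>"
    using assms by (auto simp: borel_probs_def)
  interpret b: prob_space \<beta> by fact
  interpret c: prob_space \<gamma> by fact
  \<comment> \<open>The empty set is treated apart because \<open>infdist x {} = 0\<close> by
    convention, so the approximating functions would be constantly \<open>1\<close>.\<close>
  have eqC: "emeasure \<beta> C = emeasure \<gamma> C" if C: "closed C" for C
  proof (cases "C = {}")
    case False
    have *: "1 + infdist x C \<noteq> 0" for x using infdist_nonneg[of x C] by linarith
    have "continuous_on UNIV (\<lambda>x. (1 / (1 + infdist x C)) ^ n)" for n
      by (intro continuous_intros) (use * in auto)
    from eq[OF this] have "measure \<beta> C = measure \<gamma> C"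
      using closed_lim[OF C False assms(2)] closed_lim[OF C False assms(3)] LIMSEQ_unique by simp
    then show ?thesis
      by (simp add: b.emeasure_eq_measure c.emeasure_eq_measure)
  qed simp
  show ?thesis
  proof (rule measure_eqI_generator_eq[where E="Collect closed" and \<Omega>=UNIV and A="\<lambda>_. UNIV"])
    show "Int_stable (Collect closed :: 'a set set)" by (auto simp: Int_stable_def)
    show "sets \<beta> = sigma_sets UNIV (Collect closed)" "sets \<gamma> = sigma_sets UNIV (Collect closed)"
      by (auto simp: s borel_eq_closed)
  qed (auto simp: eqC)
qed

section \<open>Push-forwards and invariance\<close>

lemma action_measurable:
  assumes "nat_action T" "\<beta> \<in> borel_probs"
  shows "T j \<in> measurable \<beta> borel"
proof -
  have "sets \<beta> = sets borel" using assms by (simp add: borel_probs_def)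
  then show ?thesis
    by (subst measurable_cong_sets[OF _ refl])
      (auto intro: borel_measurable_continuous_onI nat_action_continuous[OF assms(1)])
qed

lemma distr_action_borel_probs:
  assumes "nat_action T" "\<beta> \<in> borel_probs"
  shows "distr \<beta> borel (T j) \<in> borel_probs"
  using assms prob_space.prob_space_distr[OF _ action_measurable[OF assms]]
  by (simp add: borel_probs_def)

lemma integral_distr_action:
  fixes f :: "'a::metric_space \<Rightarrow> real"
  assumes "nat_action T" "\<beta> \<in> borel_probs" "continuous_on UNIV f"
  shows "(\<integral>x. f x \<partial>distr \<beta> borel (T j)) = (\<integral>x. f (T j x) \<partial>\<beta>)"
  using action_measurable[OF assms(1,2)] assms(3)
  by (intro integral_distr borel_measurable_continuous_onI)

lemma invariant_probs_distr:
  assumes "nat_action T" "\<beta> \<in> invariant_probs T"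
  shows "distr \<beta> borel (T j) = \<beta>"
proof (rule measure_eqI)
  have b: "\<beta> \<in> borel_probs" and s: "sets \<beta> = sets borel"
    using assms by (auto simp: invariant_probs_def borel_probs_def)
  have sp: "space \<beta> = UNIV" using sets_eq_imp_space_eq[OF s] by simp
  show "sets (distr \<beta> borel (T j)) = sets \<beta>" by (simp add: s)
  show "emeasure (distr \<beta> borel (T j)) A = emeasure \<beta> A" if "A \<in> sets (distr \<beta> borel (T j))" for A
    using that assms action_measurable[OF assms(1) b] emeasure_distr[of "T j" \<beta> borel A]
    by (auto simp: invariant_probs_def sp)
qed

lemma invariant_probs_integral:
  fixes f :: "'a::metric_space \<Rightarrow> real"
  assumes "nat_action T" "\<beta> \<in> invariant_probs T" "continuous_on UNIV f"
  shows "(\<integral>x. f (T j x) \<partial>\<beta>) = (\<integral>x. f x \<partial>\<beta>)"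
  using integral_distr_action[OF assms(1) _ assms(3), of \<beta> j] invariant_probs_distr[OF assms(1,2)] assms(2)
  by (simp add: invariant_probs_def)

text \<open>Telescoping will give invariance only for \<open>T 1\<close> and only against continuous
  functions. Using the hypothesis for \<open>f\<close> composed with \<open>T j\<close> gives all
  \<open>T j\<close> by induction, and \<open>borel_probs_eqI\<close>, applied to the push-forward,
  passes to Borel sets.\<close>

lemma invariant_probsI:
  fixes \<beta> :: "'a::metric_space measure"
  assumes cpt: "compact (UNIV :: 'a set)" and T: "nat_action T" and \<beta>: "\<beta> \<in> borel_probs"
    and inv: "\<And>f :: 'a \<Rightarrow> real. continuous_on UNIV f \<Longrightarrow> (\<integral>x. f (T 1 x) \<partial>\<beta>) = (\<integral>x. f x \<partial>\<beta>)"
  shows "\<beta> \<in> invariant_probs T"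
proof -
  have "(\<integral>x. f (T j x) \<partial>\<beta>) = (\<integral>x. f x \<partial>\<beta>)" if "continuous_on UNIV f" for f :: "'a \<Rightarrow> real" and j
  proof (induction j)
    case 0
    then show ?case using T by (simp add: nat_action_0)
  next
    case (Suc j)
    then show ?case
      using inv[OF continuous_on_action[OF T that, of j]] T by (simp add: nat_action_add)
  qed
  then have d: "distr \<beta> borel (T j) = \<beta>" for j
    using integral_distr_action[OF T \<beta>]
    by (intro borel_probs_eqI[OF cpt distr_action_borel_probs[OF T \<beta>] \<beta>]) auto
  have "space \<beta> = UNIV"
    using \<beta> sets_eq_imp_space_eq[of \<beta> borel] by (simp add: borel_probs_def)
  then have "emeasure \<beta> (T j -` A) = emeasure \<beta> A" if "A \<in> sets borel" for j A
    using emeasure_distr[OF action_measurable[OF T \<beta>] that, of j] by (simp add: d)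
  then show ?thesis using \<beta> by (simp add: invariant_probs_def)
qed

text \<open>Drawing \<open>j\<close> uniformly from \<open>F\<close> and then pushing
  \<open>\<beta>\<close> forward by \<open>T j\<close> produces the averaged measure. In this form
  its total mass and its integrals follow from the general rules for \<open>bind\<close>.\<close>

lemma avg_eq_bind:
  assumes T: "nat_action T" and \<beta>: "\<beta> \<in> borel_probs" and F: "finite F" "F \<noteq> {}"
  shows "avg T F \<beta> = measure_pmf (pmf_of_set F) \<bind> (\<lambda>j. distr \<beta> borel (T j))"
    and "(\<lambda>j. distr \<beta> borel (T j)) \<in> measurable (measure_pmf (pmf_of_set F)) (subprob_algebra borel)"
proof -
  have s: "sets \<beta> = sets borel" using \<beta> by (simp add: borel_probs_def)
  have sp: "space \<beta> = UNIV" using sets_eq_imp_space_eq[OF s] by simp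
  show N: "(\<lambda>j. distr \<beta> borel (T j)) \<in> measurable (measure_pmf (pmf_of_set F)) (subprob_algebra borel)"
    using distr_action_borel_probs[OF T \<beta>]
    by (auto simp: space_subprob_algebra borel_probs_def prob_space_imp_subprob_space)
  show "avg T F \<beta> = measure_pmf (pmf_of_set F) \<bind> (\<lambda>j. distr \<beta> borel (T j))"
  proof (rule measure_eqI)
    have a: "sets (avg T F \<beta>) = sets borel"
      unfolding avg_def by (simp add: sets.sigma_sets_eq[of borel, simplified])
    show "sets (avg T F \<beta>) = sets (measure_pmf (pmf_of_set F) \<bind> (\<lambda>j. distr \<beta> borel (T j)))"
      by (subst sets_bind[of _ _ borel]) (auto simp: a)
    fix A assume "A \<in> sets (avg T F \<beta>)"
    then have A: "A \<in> sets borel" by (simp add: a)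
    have "emeasure (distr \<beta> borel (T j)) A = emeasure \<beta> (T j -` A)" for j
      using emeasure_distr[OF action_measurable[OF T \<beta>] A] by (simp add: sp)
    then show "emeasure (avg T F \<beta>) A = emeasure (measure_pmf (pmf_of_set F) \<bind> (\<lambda>j. distr \<beta> borel (T j))) A"
      using F by (simp add: emeasure_bind[OF _ N A] emeasure_avg[OF T s A] nn_integral_pmf_of_set)
  qed
qed

lemma avg_borel_probs:
  assumes "nat_action T" "\<beta> \<in> borel_probs" "finite F" "F \<noteq> {}"
  shows "avg T F \<beta> \<in> borel_probs"
proof -
  have "prob_space (avg T F \<beta>)"
    unfolding avg_eq_bind(1)[OF assms]
    using distr_action_borel_probs[OF assms(1,2)]
    by (intro measure_pmf.prob_space_bind[OF _ avg_eq_bind(2)[OF assms]]) (auto simp: borel_probs_def)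
  then show ?thesis
    by (simp add: borel_probs_def avg_def sets.sigma_sets_eq[of borel, simplified])
qed

lemma integral_avg:
  fixes f :: "'a::metric_space \<Rightarrow> real"
  assumes cpt: "compact (UNIV :: 'a set)" and T: "nat_action T" and \<beta>: "\<beta> \<in> borel_probs"
    and F: "finite F" "F \<noteq> {}" and f: "continuous_on UNIV f"
  shows "(\<integral>x. f x \<partial>avg T F \<beta>) = (\<Sum>j\<in>F. \<integral>x. f (T j x) \<partial>\<beta>) / real (card F)"
proof -
  note A = avg_borel_probs[OF T \<beta> F]
  interpret b: prob_space \<beta> using \<beta> by (simp add: borel_probs_def)
  interpret a: prob_space "avg T F \<beta>" using A by (simp add: borel_probs_def)
  obtain B where B: "\<And>x. \<bar>f x\<bar> \<le> B" using continuous_bounded[OF cpt f] by blast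
  \<comment> \<open>The rule for integrals over a \<open>bind\<close> is used for nonnegative
    functions. The shift by \<open>B\<close> is undone at the end, since it adds \<open>B\<close> to
    both sides, all measures being probabilities.\<close>
  define g where "g x = f x + B" for x
  have g0: "g x \<ge> 0" for x using B[of x] by (simp add: g_def)
  have g: "continuous_on UNIV g" unfolding g_def by (intro continuous_intros f)
  have gm: "g \<in> borel_measurable borel" by (rule borel_measurable_continuous_onI[OF g])
  have "ennreal (\<integral>x. g x \<partial>avg T F \<beta>) = (\<integral>\<^sup>+x. g x \<partial>avg T F \<beta>)"
    using borel_probs_integrable[OF cpt A g] g0 by (simp add: nn_integral_eq_integral)
  also have "\<dots> = (\<Sum>j\<in>F. \<integral>\<^sup>+x. g x \<partial>distr \<beta> borel (T j)) / card F"
    unfolding avg_eq_bind(1)[OF T \<beta> F]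
    using F gm by (subst nn_integral_bind[OF _ avg_eq_bind(2)[OF T \<beta> F]]) (auto simp: nn_integral_pmf_of_set)
  also have "\<dots> = (\<Sum>j\<in>F. ennreal (\<integral>x. g (T j x) \<partial>\<beta>)) / card F"
    using borel_probs_integrable[OF cpt distr_action_borel_probs[OF T \<beta>] g] g0
    by (simp add: nn_integral_eq_integral integral_distr_action[OF T \<beta> g])
  also have "\<dots> = ennreal ((\<Sum>j\<in>F. \<integral>x. g (T j x) \<partial>\<beta>) / card F)"
    using g0 F by (simp add: sum_ennreal divide_ennreal sum_nonneg card_gt_0_iff ennreal_of_nat_eq_real_of_nat)
  finally have *: "(\<integral>x. g x \<partial>avg T F \<beta>) = (\<Sum>j\<in>F. \<integral>x. g (T j x) \<partial>\<beta>) / card F"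
    by (subst (asm) ennreal_inj) (auto intro!: Bochner_Integration.integral_nonneg divide_nonneg_nonneg sum_nonneg g0)
  have "(\<integral>x. g x \<partial>avg T F \<beta>) = (\<integral>x. f x \<partial>avg T F \<beta>) + B"
    unfolding g_def using borel_probs_integrable[OF cpt A f] a.prob_space by simp
  moreover have "(\<integral>x. g (T j x) \<partial>\<beta>) = (\<integral>x. f (T j x) \<partial>\<beta>) + B" for j
    unfolding g_def using borel_probs_integrable[OF cpt \<beta> continuous_on_action[OF T f]] b.prob_space by simp
  ultimately show ?thesis
    using * F by (simp add: sum.distrib add_divide_distrib card_gt_0_iff)
qed

section \<open>Small balls and Birkhoff averages\<close>

lemma uniform_measure_borel_probs:
  assumes "\<mu> \<in> borel_probs" "measure \<mu> A > 0"
  shows "uniform_measure \<mu> A \<in> borel_probs"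
proof -
  interpret prob_space \<mu> using assms by (simp add: borel_probs_def)
  have "emeasure \<mu> A \<noteq> 0" "emeasure \<mu> A \<noteq> \<infinity>"
    using assms(2) by (auto simp: emeasure_eq_measure)
  from prob_space_uniform_measure[OF this] show ?thesis
    using assms(1) by (simp add: borel_probs_def)
qed

lemma (in prob_space) integral_close_const:
  fixes g :: "'a \<Rightarrow> real"
  assumes "integrable M g" "AE x in M. \<bar>g x - c\<bar> \<le> e"
  shows "\<bar>(\<integral>x. g x \<partial>M) - c\<bar> \<le> e"
proof -
  have "AE x in M. g x \<le> c + e" "AE x in M. c - e \<le> g x"
    using assms(2) by (auto elim!: eventually_mono)
  then have "(\<integral>x. g x \<partial>M) \<le> c + e" "c - e \<le> (\<integral>x. g x \<partial>M)"
    using integral_le_const[OF assms(1)] integral_ge_const[OF assms(1)] by auto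
  then show ?thesis by linarith
qed

text \<open>For indices outside a set of vanishing density, \<open>T j\<close> maps the whole ball
  close to \<open>T j x\<close>, so uniform continuity of \<open>f\<close> applies; the remaining
  indices cost at most \<open>2 * B\<close> each. Positivity is a premise inside the eventuality
  because it will be known only for \<open>k\<close> among the values of a sampling
  function.\<close>

lemma ball_avg_close_birkhoff:
  fixes T :: "nat \<Rightarrow> 'a::metric_space \<Rightarrow> 'a" and f :: "'a \<Rightarrow> real"
  assumes cpt: "compact (UNIV :: 'a set)" and T: "nat_action T" and \<mu>: "\<mu> \<in> borel_probs"
    and hol: "holder_action T H L" and r: "decays_fast H L (\<lambda>k. {0..<k}) r"
    and f: "continuous_on UNIV f" and "e > 0"
  shows "\<forall>\<^sub>F k in sequentially. measure \<mu> (ball x (r k)) > 0 \<longrightarrow>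
    \<bar>(\<integral>y. f y \<partial>avg T {0..<k} (uniform_measure \<mu> (ball x (r k)))) - birkhoff T k f x\<bar> \<le> e"
proof -
  obtain B where B: "B > 0" "\<And>x. \<bar>f x\<bar> \<le> B" using continuous_bounded[OF cpt f] by blast
  obtain d where d: "d > 0" "\<And>x y. dist x y < d \<Longrightarrow> \<bar>f x - f y\<bar> < e / 2"
    using continuous_uniform[OF cpt f, of "e / 2"] \<open>e > 0\<close> by auto
  \<comment> \<open>The threshold \<open>d / 2\<close> turns the non-strict bound for good indices
    into a distance strictly below \<open>d\<close>.\<close>
  define bad where "bad k = {j\<in>{0..<k}. L j * r k powr H j > d / 2}" for k
  have "(\<lambda>k. real (card (bad k)) / real k) \<longlonglongrightarrow> 0"
    using r d(1) unfolding decays_fast_def bad_def by (auto dest!: spec[of _ "d / 2"])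
  \<comment> \<open>With this density of bad indices, their cost \<open>2 * B\<close> each amounts
    to less than \<open>e / 2\<close> on average; the good ones use the other
    \<open>e / 2\<close>.\<close>
  moreover have "e / (4 * B) > 0" using B \<open>e > 0\<close> by simp
  ultimately have "\<forall>\<^sub>F k in sequentially. real (card (bad k)) / real k < e / (4 * B)"
    by (rule order_tendstoD)
  then show ?thesis
    using eventually_ge_at_top[of 1]
  proof eventually_elim
    case (elim k)
    show ?case
    proof
      assume pos: "measure \<mu> (ball x (r k)) > 0"
      let ?\<alpha> = "uniform_measure \<mu> (ball x (r k))"
      note \<alpha> = uniform_measure_borel_probs[OF \<mu> pos]
      interpret prob_space ?\<alpha> using \<alpha> by (simp add: borel_probs_def)
      have int: "integrable ?\<alpha> (\<lambda>y. f (T j y))" for j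
        by (rule borel_probs_integrable[OF cpt \<alpha> continuous_on_action[OF T f]])
      have le: "\<bar>f a - f b\<bar> \<le> 2 * B" for a b using B(2)[of a] B(2)[of b] by linarith
      have j: "\<bar>(\<integral>y. f (T j y) \<partial>?\<alpha>) - f (T j x)\<bar> \<le> e / 2 + (if j \<in> bad k then 2 * B else 0)"
        if "j < k" for j
      proof (cases "j \<in> bad k")
        case True
        then show ?thesis
          using integral_close_const[OF int, of j "f (T j x)" "2 * B"] le \<open>e > 0\<close> by simp
      next
        case False
        then have small: "L j * r k powr H j \<le> d / 2" using that by (simp add: bad_def)
        have "\<bar>f (T j y) - f (T j x)\<bar> \<le> e / 2" if "y \<in> ball x (r k)" for y
        proof -
          have "dist (T j y) (T j x) \<le> L j * dist y x powr H j"
            using hol by (simp add: holder_action_def)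
          also have "\<dots> \<le> L j * r k powr H j"
            using hol that by (intro mult_left_mono powr_mono2)
              (auto simp: holder_action_def dist_commute less_imp_le)
          finally have "dist (T j y) (T j x) < d" using small d(1) by simp
          then show ?thesis using d(2) by (simp add: less_imp_le)
        qed
        moreover have "ball x (r k) \<in> sets \<mu>" using \<mu> by (simp add: borel_probs_def)
        ultimately have "AE y in ?\<alpha>. \<bar>f (T j y) - f (T j x)\<bar> \<le> e / 2"
          by (intro AE_uniform_measureI) auto
        then have "\<bar>(\<integral>y. f (T j y) \<partial>?\<alpha>) - f (T j x)\<bar> \<le> e / 2"
          by (rule integral_close_const[OF int])
        then show ?thesis using False by simp
      qed
      have "\<bar>\<Sum>j<k. (\<integral>y. f (T j y) \<partial>?\<alpha>) - f (T j x)\<bar>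
          \<le> (\<Sum>j<k. e / 2 + (if j \<in> bad k then 2 * B else 0))"
        by (rule order_trans[OF sum_abs sum_mono]) (use j in auto)
      also have "\<dots> = real k * (e / 2) + real (card (bad k)) * (2 * B)"
      proof -
        have "{..<k} \<inter> {j. j \<in> bad k} = bad k" by (auto simp: bad_def)
        then show ?thesis by (simp add: sum.distrib sum.If_cases)
      qed
      also have "\<dots> \<le> real k * e"
      proof -
        have "real (card (bad k)) * (4 * B) \<le> e * real k"
          using elim B by (simp add: divide_less_eq less_divide_eq field_simps)
        then show ?thesis by (simp add: algebra_simps)
      qed
      finally have "\<bar>\<Sum>j<k. (\<integral>y. f (T j y) \<partial>?\<alpha>) - f (T j x)\<bar> / real k \<le> e"
        using elim by (simp add: divide_le_eq mult.commute)
      moreover have "(\<integral>y. f y \<partial>avg T {0..<k} ?\<alpha>) - birkhoff T k f x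
          = (\<Sum>j<k. (\<integral>y. f (T j y) \<partial>?\<alpha>) - f (T j x)) / real k"
        using elim by (subst integral_avg[OF cpt T \<alpha> _ _ f])
          (auto simp: birkhoff_def sum_subtractf diff_divide_distrib atLeast0LessThan lessThan_empty_iff)
      ultimately show "\<bar>(\<integral>y. f y \<partial>avg T {0..<k} ?\<alpha>) - birkhoff T k f x\<bar> \<le> e"
        by (simp add: abs_divide)
    qed
  qed
qed

subsection \<open>Countably many test functions\<close>

lemma countable_uniformly_dense:
  assumes cpt: "compact (UNIV :: 'a::metric_space set)"
  shows "\<exists>g :: nat \<Rightarrow> 'a \<Rightarrow> real. (\<forall>n. continuous_on UNIV (g n)) \<and>
    (\<forall>f e. continuous_on UNIV f \<longrightarrow> e > 0 \<longrightarrow> (\<exists>n. \<forall>x. \<bar>f x - g n x\<bar> \<le> e))"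
proof -
  have "\<exists>N::'a set. finite N \<and> UNIV \<subseteq> (\<Union>x\<in>N. ball x (1 / Suc n))" for n
    using cpt unfolding compact_eq_totally_bounded by simp
  then obtain N :: "nat \<Rightarrow> 'a set" where N: "\<And>n. finite (N n)" "\<And>n. UNIV \<subseteq> (\<Union>x\<in>N n. ball x (1 / Suc n))"
    by metis
  define D where "D = (\<Union>n. N n)"
  have "countable D" unfolding D_def using N(1) by (intro countable_UN) (auto intro: countable_finite)
  \<comment> \<open>the test functions are upper envelopes of cones of slope \<open>m\<close> with rational heights over points of \<open>D\<close>\<close>
  define env where "env m l x = foldr (\<lambda>(d, q) v. max (real_of_rat q - real m * dist x d) v) l (- real m)"
    for m :: nat and l :: "('a \<times> rat) list" and x
  \<comment> \<open>An envelope is bounded above exactly when its floor \<open>- m\<close> and each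
    cone are. Taking \<open>c = env m l x\<close> also shows that every cone lies below the
    envelope, which serves for the lower bound.\<close>
  have env_le: "env m l x \<le> c \<longleftrightarrow> - real m \<le> c \<and> (\<forall>(d, q)\<in>set l. real_of_rat q - real m * dist x d \<le> c)"
    for m l x c
    unfolding env_def by (induction l) auto
  have env_cont: "continuous_on UNIV (env m l)" for m l
    unfolding env_def by (induction l) (auto intro!: continuous_intros)
  define G where "G = (\<lambda>(m, l). env m l) ` (UNIV \<times> lists (D \<times> UNIV))"
  have "countable G"
    unfolding G_def using \<open>countable D\<close> by (intro countable_image countable_SIGMA countable_lists) auto
  moreover have "G \<noteq> {}" unfolding G_def by auto
  ultimately have G: "range (from_nat_into G) = G"
    by (simp add: range_from_nat_into)
  show ?thesis
  proof (intro exI[of _ "from_nat_into G"] conjI allI impI)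
    show "continuous_on UNIV (from_nat_into G n)" for n
    proof -
      have "from_nat_into G n \<in> G" using \<open>G \<noteq> {}\<close> by (rule from_nat_into)
      then show ?thesis unfolding G_def using env_cont by auto
    qed
    fix f :: "'a \<Rightarrow> real" and e :: real
    assume f: "continuous_on UNIV f" and "e > 0"
    obtain B where B: "B > 0" "\<And>x. \<bar>f x\<bar> \<le> B" using continuous_bounded[OF cpt f] by blast
    obtain \<delta> where \<delta>: "\<delta> > 0" "\<And>x y. dist x y < \<delta> \<Longrightarrow> \<bar>f x - f y\<bar> < e / 3"
      using continuous_uniform[OF cpt f, of "e / 3"] \<open>e > 0\<close> by auto
    \<comment> \<open>\<open>m \<ge> B\<close> keeps the floor \<open>- m\<close> below
      \<open>f\<close>. \<open>m * \<delta> \<ge> 2 * B\<close> makes every cone drop, at distance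
      \<open>\<delta>\<close> from its apex, by the largest possible oscillation of
      \<open>f\<close>, so distant cones do no harm.\<close>
    obtain m :: nat where m: "real m \<ge> max B (2 * B / \<delta>)" using real_arch_simple by blast
    then have mB: "real m \<ge> B" "real m * \<delta> \<ge> 2 * B"
      using \<delta>(1) by (auto simp: divide_le_eq)
    \<comment> \<open>The mesh is so fine that some apex lies within \<open>\<delta>\<close> of
      \<open>x\<close> and its cone loses less than \<open>e / 3\<close> on the way. The other two
      thirds pay for the oscillation of \<open>f\<close> and the rational rounding.\<close>
    obtain n :: nat where "real n \<ge> max (1 / \<delta>) (3 * real m / e)" using real_arch_simple by blast
    then have "1 / \<delta> < Suc n" "3 * real m / e < Suc n" by auto
    then have n: "1 / Suc n < \<delta>" "real m * (1 / Suc n) < e / 3"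
      using \<delta>(1) \<open>e > 0\<close> by (auto simp: field_simps)
    have "\<exists>q::rat. \<bar>of_rat q - f d\<bar> < e / 3" for d
      using of_rat_dense[of "f d" "f d + e / 3"] \<open>e > 0\<close>
      by (metis abs_of_pos add_diff_cancel_left' diff_gt_0_iff_gt diff_strict_right_mono less_add_same_cancel1 zero_less_divide_iff zero_less_numeral)
    then obtain q where q: "\<And>d. \<bar>of_rat (q d) - f d\<bar> < e / 3" by metis
    obtain ds where ds: "set ds = N n" using finite_list[OF N(1)] by blast
    define l where "l = map (\<lambda>d. (d, q d)) ds"
    have l: "set l = (\<lambda>d. (d, q d)) ` N n" by (simp add: l_def ds)
    have "env m l \<in> G" unfolding G_def by (rule image_eqI[of _ _ "(m, l)"]) (auto simp: l D_def)
    then obtain i where i: "from_nat_into G i = env m l" using G by (metis imageE)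
    have "\<bar>f x - env m l x\<bar> \<le> e" for x
    proof -
      have "env m l x \<le> f x + e"
        unfolding env_le
      proof (intro conjI ballI)
        show "- real m \<le> f x + e" using mB B(2)[of x] \<open>e > 0\<close> by linarith
        fix z assume "z \<in> set l"
        then obtain d where z: "z = (d, q d)" using l by auto
        have "real_of_rat (q d) - real m * dist x d \<le> f x + e"
        proof (cases "dist x d < \<delta>")
          case True
          then have "\<bar>f x - f d\<bar> < e / 3" by (rule \<delta>)
          moreover have "real m * dist x d \<ge> 0" by simp
          ultimately show ?thesis using q[of d] by linarith
        next
          case False
          then have "real m * \<delta> \<le> real m * dist x d" by (intro mult_left_mono) auto
          then show ?thesis using q[of d] mB B(2)[of d] B(2)[of x] by linarith
        qed
        then show "case z of (d, q) \<Rightarrow> real_of_rat q - real m * dist x d \<le> f x + e"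
          by (simp add: z)
      qed
      moreover have "f x - e \<le> env m l x"
      proof -
        have "x \<in> (\<Union>d\<in>N n. ball d (1 / Suc n))" using N(2) by blast
        then obtain d where d: "d \<in> N n" "dist d x < 1 / Suc n" by auto
        then have dx: "\<bar>f x - f d\<bar> < e / 3" using n by (intro \<delta>) (simp add: dist_commute)
        have "real m * dist x d \<le> real m * (1 / Suc n)"
          using d by (intro mult_left_mono) (auto simp: dist_commute less_imp_le)
        then have "real m * dist x d < e / 3" using n by linarith
        moreover have "real_of_rat (q d) - real m * dist x d \<le> env m l x"
          using env_le[of m l x "env m l x"] d(1) by (auto simp: l)
        ultimately show ?thesis using q[of d] dx by linarith
      qed
      ultimately show ?thesis by linarith
    qed
    then show "\<exists>n. \<forall>x. \<bar>f x - from_nat_into G n x\<bar> \<le> e"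
      using i by metis
  qed
qed

subsection \<open>Gluing orbit segments\<close>

text \<open>A derandomised law of large numbers. Points are added one at a time so that the squared
  norm of the sum grows by at most \<open>V\<close>; hence the average of \<open>p\<close> sample
  vectors has squared norm at most \<open>V / p\<close>.\<close>

lemma (in prob_space) exists_small_sum:
  fixes h :: "'i \<Rightarrow> 'a \<Rightarrow> real"
  assumes "finite I" and int: "\<And>i. i \<in> I \<Longrightarrow> integrable M (h i)"
    and zero: "\<And>i. i \<in> I \<Longrightarrow> (\<integral>x. h i x \<partial>M) = 0"
    and V: "\<And>x. (\<Sum>i\<in>I. (h i x)\<^sup>2) \<le> V"
  shows "\<exists>z. (\<Sum>i\<in>I. (\<Sum>m<p. h i (z m))\<^sup>2) \<le> real p * V"
proof (induction p)
  case 0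
  then show ?case by simp
next
  case (Suc p)
  then obtain z where z: "(\<Sum>i\<in>I. (\<Sum>m<p. h i (z m))\<^sup>2) \<le> real p * V" by blast
  define S where "S i = (\<Sum>m<p. h i (z m))" for i
  define \<phi> where "\<phi> x = (\<Sum>i\<in>I. S i * h i x)" for x
  have "(\<integral>x. \<phi> x \<partial>M) = 0"
    unfolding \<phi>_def using int zero by (subst Bochner_Integration.integral_sum) auto
  moreover have "integrable M \<phi>"
    unfolding \<phi>_def by (intro Bochner_Integration.integrable_sum integrable_mult_right int)
  \<comment> \<open>since \<open>\<phi>\<close> has mean \<open>0\<close>, the new point can be chosen to make the cross term nonpositive\<close>
  ultimately have "\<exists>x. \<phi> x \<le> 0"
    using integral_less_AE_space[of "\<lambda>_. 0" \<phi>] emeasure_space_1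
    by (metis AE_I2 Bochner_Integration.integrable_zero integral_zero less_irrefl not_le zero_neq_one)
  then obtain x where x: "\<phi> x \<le> 0" by blast
  have "(\<Sum>i\<in>I. (\<Sum>m<Suc p. h i ((z(p := x)) m))\<^sup>2) = (\<Sum>i\<in>I. (S i + h i x)\<^sup>2)"
    by (simp add: S_def)
  also have "\<dots> = (\<Sum>i\<in>I. (S i)\<^sup>2) + 2 * \<phi> x + (\<Sum>i\<in>I. (h i x)\<^sup>2)"
    by (simp add: power2_sum sum.distrib \<phi>_def sum_distrib_left algebra_simps)
  also have "\<dots> \<le> real (Suc p) * V"
    using z x V[of x] by (simp add: S_def algebra_simps)
  finally show ?case by blast
qed

lemma sum_lessThan_add:
  fixes g :: "nat \<Rightarrow> real"
  shows "(\<Sum>t<a + b. g t) = (\<Sum>t<a. g t) + (\<Sum>i<b. g (a + i))"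
  by (induction b) (auto simp: algebra_simps)

text \<open>\<open>W m\<close> counts the uncontrolled times before segment \<open>m\<close>, which
  therefore starts at \<open>m * l + W m\<close>. Up to time \<open>p * l + W p\<close>, which
  includes the gap after the last segment, each uncontrolled time costs at most \<open>B\<close> and
  each controlled one at most \<open>e\<close>.\<close>

lemma segment_sum:
  fixes g :: "nat \<Rightarrow> real" and h :: "nat \<Rightarrow> nat \<Rightarrow> real" and W :: "nat \<Rightarrow> nat"
  assumes B: "\<And>t. \<bar>g t\<bar> \<le> B" and W: "mono W"
    and close: "\<And>m i. m < p \<Longrightarrow> i < l \<Longrightarrow> \<bar>g (m * l + W m + i) - h m i\<bar> \<le> e"
  shows "\<bar>(\<Sum>t<p * l + W p. g t) - (\<Sum>m<p. \<Sum>i<l. h m i)\<bar> \<le> real (p * l) * e + real (W p) * B"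
  using close
proof (induction p)
  case 0
  have "\<bar>\<Sum>t<W 0. g t\<bar> \<le> (\<Sum>t<W 0. B)"
    by (rule order_trans[OF sum_abs sum_mono]) (rule B)
  then show ?case by simp
next
  case (Suc p)
  define w where "w = W (Suc p) - W p"
  have w: "W (Suc p) = W p + w" using monoD[OF W, of p "Suc p"] by (simp add: w_def)
  have "Suc p * l + W (Suc p) = (p * l + W p + l) + w" by (simp add: w)
  then have split: "(\<Sum>t<Suc p * l + W (Suc p). g t) = (\<Sum>t<p * l + W p. g t)
      + (\<Sum>i<l. g (p * l + W p + i)) + (\<Sum>i<w. g (p * l + W p + l + i))"
    by (simp only: sum_lessThan_add)
  have 1: "\<bar>\<Sum>i<w. g (p * l + W p + l + i)\<bar> \<le> (\<Sum>i<w. B)"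
    by (rule order_trans[OF sum_abs sum_mono]) (rule B)
  have 2: "\<bar>\<Sum>i<l. g (p * l + W p + i) - h p i\<bar> \<le> (\<Sum>i<l. e)"
    by (rule order_trans[OF sum_abs sum_mono]) (use Suc.prems in auto)
  have "\<bar>(\<Sum>t<p * l + W p. g t) - (\<Sum>m<p. \<Sum>i<l. h m i)\<bar> \<le> real (p * l) * e + real (W p) * B"
    using Suc by simp
  moreover have "real (Suc p * l) * e + real (W (Suc p)) * B
      = (real (p * l) * e + real (W p) * B) + real l * e + real w * B"
    by (simp add: w algebra_simps)
  ultimately show ?case
    using 1 2 unfolding split sum_subtractf sum_constant card_lessThan sum.lessThan_Suc by linarith
qed

text \<open>A one-point segment at \<open>x0\<close> forces the tracing orbit into \<open>U\<close>,
  and \<open>p\<close> segments of equal length carry the statistics of \<open>\<beta>\<close>. The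
  tracing scale, the number \<open>p\<close> and all gaps are fixed before \<open>K\<close>; only
  the segment length depends on \<open>K\<close>.\<close>

lemma exists_tracing_birkhoff:
  fixes T :: "nat \<Rightarrow> 'a::metric_space \<Rightarrow> 'a" and g :: "nat \<Rightarrow> 'a \<Rightarrow> real"
  assumes cpt: "compact (UNIV :: 'a set)" and T: "nat_action T"
    and vws: "very_weak_specification T" and \<beta>: "\<beta> \<in> invariant_probs T"
    and g: "\<And>i. continuous_on UNIV (g i)" and "\<epsilon> > 0" and U: "open U" "x0 \<in> U"
  shows "\<exists>K0. \<forall>K\<ge>K0. \<exists>y\<in>U. \<forall>i<n. \<bar>birkhoff T K (g i) y - (\<integral>x. g i x \<partial>\<beta>)\<bar> < \<epsilon>"
proof -
  have \<beta>': "\<beta> \<in> borel_probs" using \<beta> by (simp add: invariant_probs_def)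
  interpret prob_space \<beta> using \<beta>' by (simp add: borel_probs_def)
  \<comment> \<open>Tracing and sampling cost \<open>e\<close> per time each, half of
    \<open>\<epsilon>\<close> together; the other half is left for gaps and remainder.\<close>
  define e where "e = \<epsilon> / 4"
  have e: "e > 0" using \<open>\<epsilon> > 0\<close> by (simp add: e_def)
  have "\<forall>i. \<exists>B>0. \<forall>x. \<bar>g i x\<bar> \<le> B" using continuous_bounded[OF cpt g] by metis
  then obtain Bf where Bf: "\<And>i. Bf i > 0" "\<And>i x. \<bar>g i x\<bar> \<le> Bf i" by metis
  define B where "B = 1 + (\<Sum>i<n. Bf i)"
  have B0: "B > 0" unfolding B_def using Bf(1) by (intro add_pos_nonneg sum_nonneg) (auto simp: less_imp_le)
  have B: "\<bar>g i x\<bar> \<le> B" if "i < n" for i x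
  proof -
    have "Bf i \<le> (\<Sum>i<n. Bf i)" using that Bf(1) by (intro member_le_sum) (auto simp: less_imp_le)
    then show ?thesis using Bf(2)[of i x] by (simp add: B_def)
  qed
  have "\<forall>i. \<exists>d>0. \<forall>x y. dist x y < d \<longrightarrow> \<bar>g i x - g i y\<bar> < e"
    using continuous_uniform[OF cpt g e] by metis
  then obtain D where D: "\<And>i. D i > 0" "\<And>i x y. dist x y < D i \<Longrightarrow> \<bar>g i x - g i y\<bar> < e" by metis
  obtain d0 where d0: "d0 > 0" "ball x0 d0 \<subseteq> U" using U openE by blast
  \<comment> \<open>The entry \<open>1 / 2\<close> brings \<open>d\<close> into the range of the
    specification property, \<open>d0\<close> keeps the orbit in \<open>U\<close>, and the
    \<open>D i\<close> control the test functions.\<close>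
  define d where "d = Min (insert (1 / 2) (insert d0 (D ` {..<n})))"
  have d: "d > 0" "d < 1" "d \<le> d0" "\<And>i. i < n \<Longrightarrow> d \<le> D i"
  proof -
    show "d > 0" unfolding d_def using D(1) d0(1) by (subst Min_gr_iff) auto
    have "d \<le> 1 / 2" unfolding d_def by (intro Min_le) auto
    then show "d < 1" by simp
    show "d \<le> d0" unfolding d_def by (intro Min_le) auto
    show "d \<le> D i" if "i < n" for i unfolding d_def using that by (intro Min_le) auto
  qed
  obtain M :: "nat \<Rightarrow> nat" where M: "\<And>n a b x. is_spec n a b \<Longrightarrow> spaced M n a b \<Longrightarrow> \<exists>y. tracing T d n a b x y"
    using vws d(1,2) unfolding very_weak_specification_def by (metis greaterThanLessThan_iff)
  define I where "I i = (\<integral>x. g i x \<partial>\<beta>)" for i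
  have I: "\<bar>I i\<bar> \<le> B" if "i < n" for i
    using integral_close_const[OF borel_probs_integrable[OF cpt \<beta>' g], of i 0 B] B[OF that]
    by (simp add: I_def)
  define V where "V = real n * (2 * B)\<^sup>2"
  \<comment> \<open>Then \<open>p * V \<le> (p * e)\<^sup>2\<close>, so sampling at \<open>p\<close>
    points gives an average error of at most \<open>e\<close> for each test function.\<close>
  obtain p :: nat where "real p \<ge> max 1 (V / e\<^sup>2)" using real_arch_simple by blast
  then have p: "p \<ge> 1" "V \<le> real p * e\<^sup>2" using e by (auto simp: divide_le_eq)
  \<comment> \<open>The leading \<open>1\<close> is the time spent at \<open>x0\<close>. The index
    is shifted by two because entry \<open>1\<close> of the specification is that point, so segment
    \<open>j\<close>, counted from \<open>0\<close>, is entry \<open>j + 2\<close>.\<close>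
  define W where "W m = 1 + (\<Sum>j\<le>m. M (j + 2))" for m
  have W: "mono W" unfolding W_def by (intro monoI add_left_mono sum_mono2) auto
  \<comment> \<open>All times outside the segments: \<open>W p\<close> in gaps and at
    \<open>x0\<close>, and fewer than \<open>p\<close> in the remainder of the division
    below.\<close>
  define C where "C = W p + p"
  obtain K0 :: nat where K0: "real K0 > 4 * B * real C / \<epsilon> + real C" using reals_Archimedean2 by blast
  have K0C: "K0 \<ge> C"
  proof -
    have "4 * B * real C / \<epsilon> \<ge> 0" using B0 \<open>\<epsilon> > 0\<close> by simp
    then show ?thesis using K0 by linarith
  qed
  show ?thesis
  proof (intro exI allI impI)
    fix K assume K: "K \<ge> K0"
    then have KC: "K \<ge> C" using K0C by simp
    define l where "l = (K - W p) div p"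
    define w where "w = (K - W p) mod p"
    have "p * l + w = K - W p" unfolding l_def w_def by simp
    then have Keq: "K = p * l + W p + w" using KC by (simp add: C_def)
    have w: "w < p" using p by (simp add: w_def)
    have l: "l \<ge> 1"
    proof -
      have "p div p \<le> l" unfolding l_def using KC by (intro div_le_mono) (simp add: C_def)
      then show ?thesis using p by simp
    qed
    define h where "h i x = birkhoff T l (g i) x - I i" for i x
    have hb: "\<bar>h i x\<bar> \<le> 2 * B" if "i < n" for i x
      using birkhoff_bounded[of "g i" B l T x] B[OF that] I[OF that] l by (simp add: h_def)
    have hint: "integrable \<beta> (h i)" for i
      unfolding h_def using borel_probs_integrable[OF cpt \<beta>' continuous_on_birkhoff[OF T g]] by simp
    \<comment> \<open>Invariance makes this mean the same for all \<open>l\<close>, so the bound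
      \<open>V\<close> and the number \<open>p\<close> can be chosen independently of
      \<open>l\<close>.\<close>
    have "(\<integral>x. birkhoff T l (g i) x \<partial>\<beta>) = I i" for i
    proof -
      have "(\<integral>x. (\<Sum>j<l. g i (T j x)) \<partial>\<beta>) = (\<Sum>j<l. I i)"
        unfolding I_def using borel_probs_integrable[OF cpt \<beta>' continuous_on_action[OF T g]]
        by (subst Bochner_Integration.integral_sum) (auto simp: invariant_probs_integral[OF T \<beta> g])
      then show ?thesis using l by (simp add: birkhoff_def)
    qed
    then have hzero: "(\<integral>x. h i x \<partial>\<beta>) = 0" for i
      unfolding h_def using borel_probs_integrable[OF cpt \<beta>' continuous_on_birkhoff[OF T g]] prob_space by simp
    have hV: "(\<Sum>i<n. (h i x)\<^sup>2) \<le> V" for x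
    proof -
      have "(h i x)\<^sup>2 \<le> (2 * B)\<^sup>2" if "i < n" for i
        using power_mono[OF hb[OF that, of x], of 2] by simp
      then have "(\<Sum>i<n. (h i x)\<^sup>2) \<le> (\<Sum>i<n. (2 * B)\<^sup>2)" by (intro sum_mono) auto
      then show ?thesis by (simp add: V_def)
    qed
    obtain z where z: "(\<Sum>i<n. (\<Sum>m<p. h i (z m))\<^sup>2) \<le> real p * V"
      using exists_small_sum[of "{..<n}" h V p] hint hzero hV by auto
    have zi: "\<bar>\<Sum>m<p. h i (z m)\<bar> \<le> real p * e" if "i < n" for i
    proof -
      have "(\<Sum>m<p. h i (z m))\<^sup>2 \<le> (\<Sum>i<n. (\<Sum>m<p. h i (z m))\<^sup>2)"
        using that by (intro member_le_sum[where f="\<lambda>i. (\<Sum>m<p. h i (z m))\<^sup>2"]) auto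
      also have "\<dots> \<le> real p * (real p * e\<^sup>2)"
        using z p(2) by (meson mult_left_mono of_nat_0_le_iff order_trans)
      also have "\<dots> = (real p * e)\<^sup>2" by (simp add: power2_eq_square)
      finally show ?thesis using e by (simp add: abs_le_square_iff[symmetric] abs_mult)
    qed
    \<comment> \<open>Entry \<open>1\<close> is the single time \<open>1\<close>; entry
      \<open>m + 2\<close> covers exactly \<open>l\<close> times, starting at
      \<open>1 + m * l + W m\<close>.\<close>
    define a where "a j = (if j \<le> 1 then 1 else 1 + (j - 2) * l + W (j - 2))" for j
    define b where "b j = (if j \<le> 1 then 1 else (j - 2) * l + W (j - 2) + l)" for j
    define \<xi> where "\<xi> j = (if j \<le> 1 then x0 else z (j - 2))" for j
    have "is_spec (p + 1) a b" using l by (auto simp: is_spec_def a_def b_def)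
    moreover have "spaced M (p + 1) a b"
      unfolding spaced_def
    proof
      fix j assume j: "j \<in> {2..p + 1}"
      show "int (M j) \<le> int (a j) - int (b (j - 1))"
      proof (cases "j = 2")
        case True
        then show ?thesis by (simp add: a_def b_def W_def numeral_2_eq_2)
      next
        case False
        with j have "j = (j - 3) + 3" by auto
        then obtain m where m: "j = m + 3" by blast
        have "W (Suc m) = W m + M j" by (simp add: W_def m numeral_3_eq_3)
        moreover have "a j = 1 + (l + m * l) + W (Suc m)" "b (j - 1) = m * l + W m + l"
          by (simp_all add: a_def b_def m)
        ultimately show ?thesis by simp
      qed
    qed
    ultimately obtain y where y: "tracing T d (p + 1) a b \<xi> y" using M by blast
    \<comment> \<open>\<open>a 1 = 1\<close>, so it is \<open>T 1 y\<close>, not \<open>y\<close>, that is close to \<open>x0\<close>\<close>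
    define y' where "y' = T 1 y"
    have "dist (T 0 (\<xi> 1)) (T (a 1 + 0) y) < d"
      using y unfolding tracing_def by (metis add.commute atLeastAtMost_iff le_add1 le_refl zero_le)
    then have "dist x0 y' < d" by (simp add: \<xi>_def a_def y'_def nat_action_0[OF T])
    then have y'U: "y' \<in> U" using d0 d by auto
    have tr: "dist (T i (z m)) (T (m * l + W m + i) y') < d" if "m < p" "i < l" for m i
    proof -
      have "m + 2 \<in> {1..p + 1}" "i \<in> {0..b (m + 2) - a (m + 2)}"
        using that by (auto simp: a_def b_def)
      then have "dist (T i (\<xi> (m + 2))) (T (a (m + 2) + i) y) < d"
        using y unfolding tracing_def by blast
      moreover have "T (a (m + 2) + i) y = T (m * l + W m + i) y'"
        by (simp add: a_def y'_def nat_action_add[OF T])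
      ultimately show ?thesis by (simp add: \<xi>_def)
    qed
    have "\<bar>birkhoff T K (g i) y' - I i\<bar> < \<epsilon>" if i: "i < n" for i
    proof -
      \<comment> \<open>The distance from \<open>?S\<close> to \<open>K * I i\<close> is split into
        four errors: tracing with gaps, the remainder of length \<open>w\<close>, the sampling
        error, and the normalisation by \<open>p * l\<close> instead of \<open>K\<close>.\<close>
      let ?S = "\<Sum>t<K. g i (T t y')" and ?S' = "\<Sum>t<p * l + W p. g i (T t y')"
      let ?H = "\<Sum>m<p. \<Sum>j<l. g i (T j (z m))"
      have 1: "\<bar>?S' - ?H\<bar> \<le> real (p * l) * e + real (W p) * B"
      proof (rule segment_sum[OF _ W])
        show "\<bar>g i (T t y')\<bar> \<le> B" for t by (rule B[OF i])
        show "\<bar>g i (T (m * l + W m + j) y') - g i (T j (z m))\<bar> \<le> e" if "m < p" "j < l" for m j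
          using tr[OF that] d(4)[OF i] D(2)[of "T (m * l + W m + j) y'" "T j (z m)" i]
          by (simp add: dist_commute less_imp_le)
      qed
      have "\<bar>\<Sum>j<w. g i (T (p * l + W p + j) y')\<bar> \<le> (\<Sum>j<w. B)"
        by (rule order_trans[OF sum_abs sum_mono]) (rule B[OF i])
      moreover have "?S = ?S' + (\<Sum>j<w. g i (T (p * l + W p + j) y'))"
        unfolding Keq by (rule sum_lessThan_add)
      ultimately have 2: "\<bar>?S - ?S'\<bar> \<le> real w * B" by simp
      have "?H = (\<Sum>m<p. real l * (h i (z m) + I i))"
        using l by (intro sum.cong) (auto simp: h_def birkhoff_def)
      also have "\<dots> = real l * (\<Sum>m<p. h i (z m)) + real (p * l) * I i"
        by (simp add: sum_distrib_left sum.distrib algebra_simps)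
      finally have "\<bar>?H - real (p * l) * I i\<bar> = real l * \<bar>\<Sum>m<p. h i (z m)\<bar>"
        by (simp add: abs_mult)
      also have "\<dots> \<le> real l * (real p * e)" by (intro mult_left_mono zi[OF i]) simp
      finally have 3: "\<bar>?H - real (p * l) * I i\<bar> \<le> real (p * l) * e" by (simp add: mult.assoc mult.left_commute)
      have "\<bar>real (p * l) * I i - real K * I i\<bar> = real (W p + w) * \<bar>I i\<bar>"
      proof -
        have "real (p * l) * I i - real K * I i = - (real (W p + w) * I i)"
          unfolding Keq by (simp add: algebra_simps)
        then show ?thesis by (simp add: abs_mult)
      qed
      also have "\<dots> \<le> real (W p + w) * B" by (intro mult_left_mono I[OF i]) simp
      finally have 4: "\<bar>real (p * l) * I i - real K * I i\<bar> \<le> real (W p) * B + real w * B"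
        by (simp add: algebra_simps)
      have "real w * B \<le> real p * B" using w B0 by (intro mult_right_mono) auto
      moreover have "real (p * l) * e \<le> real K * e" using e Keq by (intro mult_right_mono) auto
      moreover have "real C * B = real (W p) * B + real p * B" by (simp add: C_def algebra_simps)
      ultimately have "\<bar>?S - real K * I i\<bar> \<le> 2 * (real K * e) + 2 * (real C * B)"
        using 1 2 3 4 by linarith
      also have "\<dots> < real K * \<epsilon>"
      proof -
        have "4 * B * real C / \<epsilon> < real K" using K0 K by linarith
        then have "4 * B * real C < real K * \<epsilon>" using \<open>\<epsilon> > 0\<close> by (simp add: divide_less_eq)
        then show ?thesis by (simp add: e_def algebra_simps)
      qed
      finally have "\<bar>?S - real K * I i\<bar> < real K * \<epsilon>" .
      moreover have "K > 0" using KC p by (simp add: C_def)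
      moreover from this have "birkhoff T K (g i) y' - I i = (?S - real K * I i) / real K"
        by (simp add: birkhoff_def field_simps)
      ultimately show ?thesis by (simp add: abs_divide divide_less_eq mult.commute)
    qed
    then show "\<exists>y\<in>U. \<forall>i<n. \<bar>birkhoff T K (g i) y - (\<integral>x. g i x \<partial>\<beta>)\<bar> < \<epsilon>"
      using y'U unfolding I_def by blast
  qed
qed

subsection \<open>Generic points\<close>

text \<open>Baire's theorem in its form for locally compact regular spaces, because compactness is a
  hypothesis on \<open>UNIV\<close> and not a class of the type.\<close>

lemma residualI_compact:
  fixes S :: "'a::metric_space set"
  assumes "compact (UNIV :: 'a set)" "countable \<G>" "\<Inter>\<G> \<subseteq> S"
    and \<G>: "\<And>U. U \<in> \<G> \<Longrightarrow> open U \<and> closure U = UNIV"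
  shows "residual S"
proof -
  have "compact_space (euclidean :: 'a topology)" using assms(1) by (simp add: compact_space_def)
  moreover have "regular_space (euclidean :: 'a topology)"
    by (simp add: metrizable_imp_regular_space metrizable_space_euclidean)
  ultimately have "closure (\<Inter>\<G>) = UNIV"
    using Baire_category[of "euclidean :: 'a topology" \<G>] assms
    by (simp add: compact_imp_locally_compact_space)
  moreover have "gdelta_in euclidean (\<Inter>\<G>)"
  proof (cases "\<G> = {}")
    case True
    then show ?thesis by (metis Inter_empty gdelta_in_topspace topspace_euclidean)
  next
    case False
    then show ?thesis using assms by (intro gdelta_in_Inter) (auto intro: open_imp_gdelta_in)
  qed
  ultimately show ?thesis using assms(3) unfolding residual_def by blast
qed

lemma birkhoff_limit_uniformly_dense:
  fixes g :: "nat \<Rightarrow> 'a::metric_space \<Rightarrow> real"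
  assumes cpt: "compact (UNIV :: 'a set)" and \<beta>: "\<beta> \<in> borel_probs"
    and g: "\<And>i. continuous_on UNIV (g i)" and \<kappa>: "\<And>n. \<kappa> n > 0"
    and lim: "\<And>i. (\<lambda>n. birkhoff T (\<kappa> n) (g i) x) \<longlonglongrightarrow> (\<integral>x. g i x \<partial>\<beta>)"
    and f: "continuous_on UNIV f" and dense: "\<And>e. e > 0 \<Longrightarrow> \<exists>i. \<forall>x. \<bar>f x - g i x\<bar> \<le> e"
  shows "(\<lambda>n. birkhoff T (\<kappa> n) f x) \<longlonglongrightarrow> (\<integral>x. f x \<partial>\<beta>)"
proof (rule tendstoI)
  fix e :: real assume "e > 0"
  interpret prob_space \<beta> using \<beta> by (simp add: borel_probs_def)
  obtain i where i: "\<And>x. \<bar>f x - g i x\<bar> \<le> e / 3" using dense[of "e / 3"] \<open>e > 0\<close> by auto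
  have fi: "integrable \<beta> f" "integrable \<beta> (g i)"
    using borel_probs_integrable[OF cpt \<beta>] f g by auto
  have "\<bar>(\<integral>x. f x - g i x \<partial>\<beta>) - 0\<bar> \<le> e / 3"
    by (rule integral_close_const) (use i fi in auto)
  then have 1: "\<bar>(\<integral>x. f x \<partial>\<beta>) - (\<integral>x. g i x \<partial>\<beta>)\<bar> \<le> e / 3" using fi by simp
  have "\<forall>\<^sub>F n in sequentially. dist (birkhoff T (\<kappa> n) (g i) x) (\<integral>x. g i x \<partial>\<beta>) < e / 3"
    using lim \<open>e > 0\<close> by (intro tendstoD) auto
  then show "\<forall>\<^sub>F n in sequentially. dist (birkhoff T (\<kappa> n) f x) (\<integral>x. f x \<partial>\<beta>) < e"
  proof eventually_elim
    case (elim n)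
    have "\<bar>birkhoff T (\<kappa> n) f x - birkhoff T (\<kappa> n) (g i) x\<bar> \<le> e / 3"
      by (rule birkhoff_close[OF i \<kappa>])
    then show ?case using elim 1 unfolding dist_real_def by linarith
  qed
qed

text \<open>The set involves neither \<open>\<mu>\<close> nor any radii, so a single residual set
  serves all fast decaying sequences. Invariant measures may be uncountably many; rational vectors
  approximating their integrals stand in for them to keep the intersection countable.\<close>

lemma residual_birkhoff_limits:
  fixes T :: "nat \<Rightarrow> 'a::metric_space \<Rightarrow> 'a"
  assumes cpt: "compact (UNIV :: 'a set)" and T: "nat_action T"
    and vws: "very_weak_specification T" and P: "sampling_family \<P>" "countable \<P>"
  shows "residual {x. \<forall>\<pi>\<in>\<P>. \<forall>\<beta>\<in>invariant_probs T. \<exists>s. strict_mono s \<and> (\<forall>i. s i \<ge> 1) \<and>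
    (\<forall>f. continuous_on UNIV f \<longrightarrow> (\<lambda>i. birkhoff T (\<pi> (s i)) f x) \<longlonglongrightarrow> (\<integral>x. f x \<partial>\<beta>))}"
    (is "residual ?S")
proof -
  obtain g :: "nat \<Rightarrow> 'a \<Rightarrow> real" where g: "\<And>n. continuous_on UNIV (g n)"
    and dense: "\<And>f e. continuous_on UNIV f \<Longrightarrow> e > 0 \<Longrightarrow> \<exists>n. \<forall>x. \<bar>f x - g n x\<bar> \<le> e"
    using countable_uniformly_dense[OF cpt] by metis
  define U where "U \<pi> N n q = {x. \<exists>k\<ge>N. \<forall>i<n.
      \<bar>birkhoff T (\<pi> k) (g i) x - real_of_rat (q ! i)\<bar> < 2 / Suc n}" for \<pi> and N n :: nat and q :: "rat list"
  \<comment> \<open>Only vectors close to an actual invariant measure are kept, since density of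
    \<open>U\<close> is available just for these. The errors \<open>1 / Suc n\<close> here and
    \<open>2 / Suc n\<close> in \<open>U\<close> add up to the \<open>3 / Suc n\<close>
    below.\<close>
  define near where "near \<beta> n q \<longleftrightarrow> (\<forall>i<n. \<bar>(\<integral>x. g i x \<partial>\<beta>) - real_of_rat (q ! i)\<bar> < 1 / Suc n)"
    for \<beta> n and q :: "rat list"
  define \<G> where "\<G> = (\<lambda>(\<pi>, N, n, q). U \<pi> N n q) `
      (\<P> \<times> UNIV \<times> {(n, q). \<exists>\<beta>\<in>invariant_probs T. near \<beta> n q})"
  show ?thesis
  proof (rule residualI_compact[OF cpt, of \<G>])
    show "countable \<G>" unfolding \<G>_def using P(2)
      by (intro countable_image countable_SIGMA) auto
  next
    fix A assume "A \<in> \<G>"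
    then obtain \<pi> N n q \<beta> where A: "A = U \<pi> N n q" and \<pi>: "\<pi> \<in> \<P>" and \<beta>: "\<beta> \<in> invariant_probs T" "near \<beta> n q"
      unfolding \<G>_def by auto
    have "U \<pi> N n q = (\<Union>k\<in>{N..}. \<Inter>i\<in>{..<n}. {x. \<bar>birkhoff T (\<pi> k) (g i) x - real_of_rat (q ! i)\<bar> < 2 / Suc n})"
      by (auto simp: U_def)
    moreover have "open {x. \<bar>birkhoff T (\<pi> k) (g i) x - real_of_rat (q ! i)\<bar> < 2 / Suc n}" for k i
      by (intro open_Collect_less continuous_on_rabs continuous_on_diff continuous_on_const continuous_on_birkhoff[OF T g])
    ultimately have "open A" unfolding A by (metis (no_types, lifting) open_UN open_INT finite_lessThan)
    moreover have "A \<inter> Y \<noteq> {}" if Y: "open Y" "Y \<noteq> {}" for Y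
    proof -
      obtain x0 where "x0 \<in> Y" using Y by blast
      then obtain K0 where K0: "\<And>K. K \<ge> K0 \<Longrightarrow>
          \<exists>y\<in>Y. \<forall>i<n. \<bar>birkhoff T K (g i) y - (\<integral>x. g i x \<partial>\<beta>)\<bar> < 1 / Suc n"
        using exists_tracing_birkhoff[where g = g and n = n, OF cpt T vws \<beta>(1) g _ Y(1), of "1 / Suc n" x0]
        by auto
      \<comment> \<open>Gluing works for every large length, so any late \<open>k\<close> will do,
        whatever the values of \<open>\<pi>\<close> are.\<close>
      have "filterlim \<pi> at_top sequentially" using P(1) \<pi> by (simp add: sampling_family_def)
      then have "\<forall>\<^sub>F k in sequentially. \<pi> k \<ge> K0 \<and> k \<ge> N"
        by (intro eventually_conj eventually_ge_at_top) (simp add: filterlim_at_top)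
      then obtain k where k: "\<pi> k \<ge> K0" "k \<ge> N"
        using eventually_happens[of _ sequentially] by auto
      then obtain y where y: "y \<in> Y" "\<And>i. i < n \<Longrightarrow> \<bar>birkhoff T (\<pi> k) (g i) y - (\<integral>x. g i x \<partial>\<beta>)\<bar> < 1 / Suc n"
        using K0 by blast
      have "\<bar>birkhoff T (\<pi> k) (g i) y - real_of_rat (q ! i)\<bar> < 2 / Suc n" if "i < n" for i
      proof -
        have "\<bar>(\<integral>x. g i x \<partial>\<beta>) - real_of_rat (q ! i)\<bar> < 1 / Suc n"
          using \<beta>(2) that unfolding near_def by blast
        moreover have "2 / real (Suc n) = 1 / Suc n + 1 / Suc n" by simp
        ultimately show ?thesis using y(2)[OF that] by linarith
      qed
      then have "y \<in> A" unfolding A U_def using k(2) by blast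
      then show ?thesis using y(1) by blast
    qed
    then have "closure A = UNIV"
      using closure_subset[of A] open_Compl[OF closed_closure[of A]] by blast
    ultimately show "open A \<and> closure A = UNIV" by blast
  next
    show "\<Inter>\<G> \<subseteq> ?S"
    proof (intro subsetI CollectI ballI)
      fix x \<pi> \<beta>
      assume x: "x \<in> \<Inter>\<G>" and \<pi>: "\<pi> \<in> \<P>" and \<beta>: "\<beta> \<in> invariant_probs T"
      have \<beta>': "\<beta> \<in> borel_probs" using \<beta> by (simp add: invariant_probs_def)
      define Q where "Q n k \<longleftrightarrow> k \<ge> 1 \<and> (\<forall>i<n. \<bar>birkhoff T (\<pi> k) (g i) x - (\<integral>x. g i x \<partial>\<beta>)\<bar> < 3 / Suc n)" for n k
      have step: "\<exists>k. Q n k \<and> N < k" for N n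
      proof -
        have "\<exists>q. \<bar>(\<integral>x. g i x \<partial>\<beta>) - real_of_rat q\<bar> < 1 / Suc n" for i
        proof -
          obtain q where "(\<integral>x. g i x \<partial>\<beta>) < real_of_rat q" "real_of_rat q < (\<integral>x. g i x \<partial>\<beta>) + 1 / Suc n"
            using of_rat_dense[of "\<integral>x. g i x \<partial>\<beta>" "(\<integral>x. g i x \<partial>\<beta>) + 1 / Suc n"] by auto
          then show ?thesis by (intro exI[of _ q]) linarith
        qed
        then obtain q where q: "\<And>i. \<bar>(\<integral>x. g i x \<partial>\<beta>) - real_of_rat (q i)\<bar> < 1 / Suc n" by metis
        define l where "l = map q [0..<n]"
        have l: "l ! i = q i" if "i < n" for i using that by (simp add: l_def)
        have "near \<beta> n l" using q l by (simp add: near_def)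
        then have "U \<pi> (Suc N) n l \<in> \<G>" unfolding \<G>_def using \<pi> \<beta> by force
        then obtain k where k: "k \<ge> Suc N" "\<And>i. i < n \<Longrightarrow> \<bar>birkhoff T (\<pi> k) (g i) x - real_of_rat (l ! i)\<bar> < 2 / Suc n"
          using x unfolding U_def by blast
        have "\<bar>birkhoff T (\<pi> k) (g i) x - (\<integral>x. g i x \<partial>\<beta>)\<bar> < 3 / Suc n" if "i < n" for i
        proof -
          have "3 / real (Suc n) = 2 / Suc n + 1 / Suc n" by (simp add: add_divide_distrib[symmetric])
          then show ?thesis using k(2)[OF that] q[of i] l[OF that] by simp
        qed
        then show ?thesis using k(1) by (intro exI[of _ k]) (auto simp: Q_def)
      qed
      \<comment> \<open>A diagonal choice: at stage \<open>n\<close> the first \<open>n\<close> test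
        functions are controlled, hence each fixed one from some stage on.\<close>
      obtain s where s: "\<And>n. Q n (s n)" "\<And>n. s n < s (Suc n)"
        using dependent_nat_choice[of Q "\<lambda>_ a b. a < b"] step by metis
      have s1: "s i \<ge> 1" for i using s(1) by (simp add: Q_def)
      have lim: "(\<lambda>n. birkhoff T (\<pi> (s n)) (g i) x) \<longlonglongrightarrow> (\<integral>x. g i x \<partial>\<beta>)" for i
      proof (rule LIM_zero_cancel, rule Lim_null_comparison)
        show "\<forall>\<^sub>F n in sequentially. norm (birkhoff T (\<pi> (s n)) (g i) x - (\<integral>x. g i x \<partial>\<beta>)) \<le> 3 / Suc n"
          using eventually_gt_at_top[of i]
        proof eventually_elim
          case (elim n)
          then show ?case using s(1)[of n] by (simp add: Q_def less_imp_le)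
        qed
        show "(\<lambda>n. 3 / real (Suc n)) \<longlonglongrightarrow> 0"
          using LIMSEQ_Suc[OF lim_const_over_n[of "3::real"]] by simp
      qed
      have "\<pi> (s n) > 0" for n
        using P(1) \<pi> s1[of n] unfolding sampling_family_def by (metis less_le_trans zero_less_one)
      then have "(\<lambda>n. birkhoff T (\<pi> (s n)) f x) \<longlonglongrightarrow> (\<integral>x. f x \<partial>\<beta>)" if "continuous_on UNIV f" for f
        using birkhoff_limit_uniformly_dense[where g = g, OF cpt \<beta>' g _ lim that] dense[OF that] by blast
      moreover have "strict_mono s" using s(2) by (rule strict_mono_Suc_iff[THEN iffD2, rule_format])
      ultimately show "\<exists>s. strict_mono s \<and> (\<forall>i. s i \<ge> 1) \<and>
          (\<forall>f. continuous_on UNIV f \<longrightarrow> (\<lambda>i. birkhoff T (\<pi> (s i)) f x) \<longlonglongrightarrow> (\<integral>x. f x \<partial>\<beta>))"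
        using s1 by blast
    qed
  qed
qed

text \<open>By \<open>birkhoff_shift\<close>, replacing \<open>f\<close> by its composition with
  \<open>T 1\<close> changes the averages by at most \<open>2 * B / \<kappa> n\<close>, which tends
  to \<open>0\<close>.\<close>

lemma invariant_limit:
  fixes T :: "nat \<Rightarrow> 'a::metric_space \<Rightarrow> 'a"
  assumes cpt: "compact (UNIV :: 'a set)" and T: "nat_action T" and \<beta>: "\<beta> \<in> borel_probs"
    and \<kappa>: "filterlim \<kappa> at_top sequentially"
    and lim: "\<And>f. continuous_on UNIV f \<Longrightarrow> (\<lambda>n. birkhoff T (\<kappa> n) f x) \<longlonglongrightarrow> (\<integral>x. f x \<partial>\<beta>)"
  shows "\<beta> \<in> invariant_probs T"
proof (rule invariant_probsI[OF cpt T \<beta>])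
  fix f :: "'a \<Rightarrow> real" assume f: "continuous_on UNIV f"
  obtain B where B: "\<And>x. \<bar>f x\<bar> \<le> B" using continuous_bounded[OF cpt f] by blast
  have "(\<lambda>n. birkhoff T (\<kappa> n) (\<lambda>x. f (T 1 x)) x - birkhoff T (\<kappa> n) f x) \<longlonglongrightarrow> 0"
  proof (rule Lim_null_comparison)
    show "\<forall>\<^sub>F n in sequentially. norm (birkhoff T (\<kappa> n) (\<lambda>x. f (T 1 x)) x - birkhoff T (\<kappa> n) f x) \<le> 2 * B / real (\<kappa> n)"
    \<comment> \<open>At \<open>\<kappa> n = 0\<close> both sides are \<open>0\<close> by the
      convention for division by zero.\<close>
    proof (intro always_eventually allI)
      fix n
      have "\<bar>f (T (\<kappa> n) x) - f x\<bar> \<le> 2 * B" using B[of x] B[of "T (\<kappa> n) x"] by linarith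
      then show "norm (birkhoff T (\<kappa> n) (\<lambda>x. f (T 1 x)) x - birkhoff T (\<kappa> n) f x) \<le> 2 * B / real (\<kappa> n)"
        unfolding birkhoff_shift[OF T] by (simp add: abs_divide divide_right_mono)
    qed
    show "(\<lambda>n. 2 * B / real (\<kappa> n)) \<longlonglongrightarrow> 0"
      using filterlim_compose[OF lim_const_over_n[of "2 * B"] \<kappa>] by simp
  qed
  moreover have "(\<lambda>n. birkhoff T (\<kappa> n) (\<lambda>x. f (T 1 x)) x - birkhoff T (\<kappa> n) f x)
      \<longlonglongrightarrow> (\<integral>x. f (T 1 x) \<partial>\<beta>) - (\<integral>x. f x \<partial>\<beta>)"
    by (intro tendsto_diff lim continuous_on_action[OF T] f)
  ultimately show "(\<integral>x. f (T 1 x) \<partial>\<beta>) = (\<integral>x. f x \<partial>\<beta>)"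
    using LIMSEQ_unique by fastforce
qed

section \<open>Back from Birkhoff averages to averaged ball measures\<close>

theorem corollary6p8:
  fixes \<mu> :: "'a::metric_space measure"
    and T :: "nat \<Rightarrow> 'a \<Rightarrow> 'a"
    and H L :: "nat \<Rightarrow> real"
    and F :: "nat \<Rightarrow> nat set"
    and \<P> :: "(nat \<Rightarrow> nat) set"
  assumes "compact (UNIV :: 'a set)"
    and "\<mu> \<in> borel_probs"
    and "nat_action T"
    and "\<And>k. F k = {0..<k}"
    and "holder_action T H L"
    and "very_weak_specification T"
    and "sampling_family \<P>"
    and "countable \<P>"
  shows "residual {x. \<forall>r. decays_fast H L F r \<longrightarrow> (\<forall>\<pi>\<in>\<P>.
           \<comment> \<open>the uniform measures on the balls around \<open>x\<close> are defined (automatic if \<open>\<mu>\<close> has full support)\<close>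
           (\<forall>k\<ge>1. measure \<mu> (ball x (r (\<pi> k))) > 0) \<longrightarrow>
           LS weak_star (\<lambda>k. avg T (F (\<pi> k)) (uniform_measure \<mu> (ball x (r (\<pi> k)))))
             = invariant_probs T)}"
    (is "residual ?R")
proof -
  note cpt = assms(1) and T = assms(3)
  have F: "F = (\<lambda>k. {0..<k})" using assms(4) by auto
  let ?S = "{x. \<forall>\<pi>\<in>\<P>. \<forall>\<beta>\<in>invariant_probs T. \<exists>s. strict_mono s \<and> (\<forall>i. s i \<ge> 1) \<and>
    (\<forall>f. continuous_on UNIV f \<longrightarrow> (\<lambda>i. birkhoff T (\<pi> (s i)) f x) \<longlonglongrightarrow> (\<integral>x. f x \<partial>\<beta>))}"
  have "?S \<subseteq> ?R"
  proof (intro subsetI CollectI allI impI ballI)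
    fix x r \<pi>
    assume x: "x \<in> ?S" and r: "decays_fast H L F r" and \<pi>: "\<pi> \<in> \<P>"
      and pos: "\<forall>k\<ge>1. measure \<mu> (ball x (r (\<pi> k))) > 0"
    define z where "z k = avg T (F (\<pi> k)) (uniform_measure \<mu> (ball x (r (\<pi> k))))" for k
    have \<pi>1: "\<pi> k \<ge> 1" if "k \<ge> 1" for k using assms(7) \<pi> that by (simp add: sampling_family_def)
    have \<pi>lim: "filterlim (\<lambda>i. \<pi> (s i)) at_top sequentially" if "strict_mono s" for s
      using assms(7) \<pi> filterlim_compose[OF _ filterlim_subseq[OF that], of \<pi>]
      by (simp add: sampling_family_def)
    have z: "z k \<in> borel_probs" if "k \<ge> 1" for k
      unfolding z_def assms(4) using that pos \<pi>1[OF that]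
      by (intro avg_borel_probs[OF T] uniform_measure_borel_probs[OF assms(2)]) auto
    \<comment> \<open>Restricting to \<open>s i \<ge> 1\<close> matters: at index \<open>0\<close>
      nothing is known about the ball or about \<open>z 0\<close>.\<close>
    have diff: "(\<lambda>i. (\<integral>y. f y \<partial>z (s i)) - birkhoff T (\<pi> (s i)) f x) \<longlonglongrightarrow> 0"
      if s: "strict_mono s" "\<And>i. s i \<ge> 1" and f: "continuous_on UNIV f" for s f
    proof (rule tendstoI)
      fix e :: real assume "e > 0"
      then have "\<forall>\<^sub>F k in sequentially. measure \<mu> (ball x (r k)) > 0 \<longrightarrow>
        \<bar>(\<integral>y. f y \<partial>avg T {0..<k} (uniform_measure \<mu> (ball x (r k)))) - birkhoff T k f x\<bar> \<le> e / 2"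
        using ball_avg_close_birkhoff[OF cpt T assms(2,5) r[unfolded F] f, of "e / 2" x] by simp
      then have "\<forall>\<^sub>F i in sequentially. measure \<mu> (ball x (r (\<pi> (s i)))) > 0 \<longrightarrow>
        \<bar>(\<integral>y. f y \<partial>z (s i)) - birkhoff T (\<pi> (s i)) f x\<bar> \<le> e / 2"
        unfolding z_def F by (rule eventually_compose_filterlim[OF _ \<pi>lim[OF s(1)]])
      then show "\<forall>\<^sub>F i in sequentially. dist ((\<integral>y. f y \<partial>z (s i)) - birkhoff T (\<pi> (s i)) f x) 0 < e"
        by (rule eventually_mono) (use pos s(2) \<open>e > 0\<close> in force)
    qed
    \<comment> \<open>From here on the radii are gone: convergence along any subsequence is a
      statement about Birkhoff averages at \<open>x\<close>.\<close>
    have lim_iff: "limitin weak_star (z \<circ> s) \<beta> sequentially \<longleftrightarrow>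
        (\<forall>f. continuous_on UNIV f \<longrightarrow> (\<lambda>i. birkhoff T (\<pi> (s i)) f x) \<longlonglongrightarrow> (\<integral>x. f x \<partial>\<beta>))"
      if s: "strict_mono s" "\<And>i. s i \<ge> 1" and "\<beta> \<in> borel_probs" for s \<beta>
    proof -
      have "(\<lambda>i. \<integral>y. f y \<partial>(z \<circ> s) i) \<longlonglongrightarrow> l \<longleftrightarrow> (\<lambda>i. birkhoff T (\<pi> (s i)) f x) \<longlonglongrightarrow> l"
        if "continuous_on UNIV f" for f l
        unfolding o_def by (rule Lim_transform_eq[OF diff[OF s that]])
      then show ?thesis
        using limitin_weak_star_iff[of "z \<circ> s" \<beta>] z s(2) \<open>\<beta> \<in> borel_probs\<close> by simp
    qed
    have "LS weak_star z = invariant_probs T"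
    \<comment> \<open>The first inclusion is the telescoping argument and does not use genericity of
      \<open>x\<close>; the second is exactly membership of \<open>x\<close> in
      \<open>?S\<close>.\<close>
    proof (intro equalityI subsetI)
      fix \<beta> assume "\<beta> \<in> LS weak_star z"
      then obtain s where s: "strict_mono s" "\<And>i. s i \<ge> 1" "limitin weak_star (z \<circ> s) \<beta> sequentially"
        by (auto simp: LS_def)
      have \<beta>: "\<beta> \<in> borel_probs" using limitin_topspace[OF s(3)] by (simp add: topspace_weak_star)
      then show "\<beta> \<in> invariant_probs T"
        using lim_iff[OF s(1,2) \<beta>] s(3) by (intro invariant_limit[OF cpt T \<beta> \<pi>lim[OF s(1)]]) auto
    next
      fix \<beta> assume \<beta>: "\<beta> \<in> invariant_probs T"
      then have \<beta>': "\<beta> \<in> borel_probs" by (simp add: invariant_probs_def)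
      obtain s where s: "strict_mono s" "\<forall>i. s i \<ge> 1"
        "\<forall>f. continuous_on UNIV f \<longrightarrow> (\<lambda>i. birkhoff T (\<pi> (s i)) f x) \<longlonglongrightarrow> (\<integral>x. f x \<partial>\<beta>)"
        using x \<pi> \<beta> by blast
      then have "limitin weak_star (z \<circ> s) \<beta> sequentially" using lim_iff[OF s(1) _ \<beta>'] by blast
      then show "\<beta> \<in> LS weak_star z" unfolding LS_def using s(1,2) by blast
    qed
    then show "LS weak_star (\<lambda>k. avg T (F (\<pi> k)) (uniform_measure \<mu> (ball x (r (\<pi> k))))) = invariant_probs T"
      unfolding z_def .
  qed
  moreover have "residual ?S"
    by (rule residual_birkhoff_limits[OF cpt T assms(6,7,8)])
  ultimately show ?thesis
    unfolding residual_def by (meson subset_trans)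
qed

end
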